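(* Let $(A,\mu,\Delta,\alpha)$ be a finite dimensional Hom-bialgebra over $\mathbf{k}$ and let $R$ be an element of $A^{\otimes 2}$. Then $(A,\mu,\Delta,\alpha,R)$ is a braided Hom-bialgebra if and only if $(A^*,\Delta^*,\mu^*,\alpha^*,R)$ is a cobraided Hom-bialgebra, where in the latter $R$ is regarded as a bilinear form on $A^*$ via evaluation. Moreover, $R=\alpha^{\otimes 2}(R)$ in $A^{\otimes 2}$ if and only if $R=R\circ(\alpha^* )^{\otimes 2}$ in $((A^* )^{\otimes 2})^*$.
   Context: $\mathbf{k}$ is a field of characteristic $0$; tensor products and linear maps are over $\mathbf{k}$; $A^*=\mathrm{Hom}(A,\mathbf{k})$, $\langle\phi,v\rangle$ denotes $\phi(v)$, $\tau(v\otimes w)=w\otimes v$. Write $\Delta(x)=\sum x_1\otimes x_2$ (Sweedler) and $xy=\mu(x,y)$. A Hom-bialgebra $(A,\mu,\Delta,\alpha)$ consists of a $\mathbf{k}$-module $A$, a bilinear map $\mu\colon A^{\otimes 2}\to A$, a linear map $\Delta\colon A\to A^{\otimes 2}$ and a linear map $\alpha\colon A\to A$ such that $\alpha\circ\mu=\mu\circ\alpha^{\otimes 2}$, $\mu\circ(\alpha\otimes\mu)=\mu\circ(\mu\otimes\alpha)$, $\alpha^{\otimes 2}\circ\Delta=\Delta\circ\alpha$, $(\alpha\otimes\Delta)\circ\Delta=(\Delta\otimes\alpha)\circ\Delta$, and $\Delta(ab)=\sum a_1b_1\otimes a_2b_2$ for all $a,b\in A$. No unit or counit is required. Dual: for a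 finite dimensional Hom-bialgebra $(A,\mu,\Delta,\alpha)$, the quadruple $(A^*,\Delta^*,\mu^*,\alpha^* )$ is a Hom-bialgebra (multiplication $\Delta^*$, comultiplication $\mu^*$, twisting map $\alpha^*$), where $\langle\Delta^*(\phi,\psi),x\rangle=\langle\phi\otimes\psi,\Delta(x)\rangle$, $\langle\mu^*(\phi),x\otimes y\rangle=\langle\phi,\mu(x,y)\rangle$ and $\alpha^*(\phi)=\phi\circ\alpha$. An element $R=\sum s_i\otimes t_i\in A^{\otimes 2}$ is regarded as the bilinear form on $A^*$ given by $R(\phi\otimes\psi)=\langle\phi\otimes\psi,R\rangle=\sum\phi(s_i)\psi(t_i)$; this is the isomorphism $A^{\otimes 2}\cong((A^* )^{\otimes 2})^*$. A braided Hom-bialgebra $(A,\mu,\Delta,\alpha,R)$ is a Hom-bialgebra $(A,\mu,\Delta,\alpha)$ with $R=\sum s_i\otimes t_i\in A^{\otimes 2}$ such that $(\Delta\otimes\alpha)(R)=R_{13}R_{23}$, $(\alpha\otimes\Delta)(R)=R_{13}R_{12}$, and $[(\tau\circ\Delta)(x)]R=R\,\Delta(x)$ for all $x\in A$, where $R_{13}R_{23}:=\sum_{i,j}\alpha(s_i)\otimes\alpha(s_j)\otimes t_it_j$, $R_{13}R_{12}:=\sum_{i,j}s_is_j\otimes\alpha(t_j)\otimes\alpha(t_i)$, and products in $A^{\otimes 2}$ are computed factorwise. A cobraided Hom-bialgebra $(A,\mu,\Delta,\alpha,R)$ is a Hom-bialgebra $(A,\mu,\Delta,\alpha)$ with a bilinear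 form $R\in\mathrm{Hom}(A^{\otimes 2},\mathbf{k})$ such that for all $x,y,z\in A$: (1) $R(xy\otimes\alpha(z))=\sum R(\alpha(x)\otimes z_1)R(\alpha(y)\otimes z_2)$; (2) $R(\alpha(x)\otimes yz)=\sum R(x_1\otimes\alpha(z))R(x_2\otimes\alpha(y))$; (3) $\sum y_1x_1R(x_2\otimes y_2)=\sum R(x_1\otimes y_1)x_2y_2$. *)

theory Defs
  imports Complex_Main "HOL-Library.Function_Algebras"
begin

section \<open>Vector spaces with a carrier, linear and bilinear maps\<close>

text \<open>
  The base field is a type \<open>'k\<close> of class \<open>field_char_0\<close>. Dual spaces and tensor products depend
  on the scalar multiplication and so cannot be types of their own. Hence a vector space is a
  subspace \<open>carr V\<close> of an ambient vector space \<open>('v, smul V)\<close>. Maps out of \<open>V\<close>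
  are relevant on \<open>carr V\<close> only.
\<close>

record ('k, 'v) vspace =
  carr :: "'v set"
  smul :: "'k \<Rightarrow> 'v \<Rightarrow> 'v"

definition is_vspace :: "('k::field_char_0, 'v::ab_group_add) vspace \<Rightarrow> bool" where
  "is_vspace V \<longleftrightarrow> vector_space (smul V) \<and> module.subspace (smul V) (carr V)"

definition finite_dim :: "('k::field_char_0, 'v::ab_group_add) vspace \<Rightarrow> bool" where
  "finite_dim V \<longleftrightarrow> (\<exists>B. finite B \<and> module.span (smul V) B = carr V)"

definition linear_map ::
  "('k::field_char_0, 'v::ab_group_add) vspace \<Rightarrow> ('k, 'w::ab_group_add) vspace \<Rightarrow> ('v \<Rightarrow> 'w) \<Rightarrow> bool"
where
  "linear_map V W f \<longleftrightarrow>
     (\<forall>x\<in>carr V. f x \<in> carr W) \<and>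
     (\<forall>x\<in>carr V. \<forall>y\<in>carr V. f (x + y) = f x + f y) \<and>
     (\<forall>c. \<forall>x\<in>carr V. f (smul V c x) = smul W c (f x))"

definition bilinear_map ::
  "('k::field_char_0, 'v::ab_group_add) vspace \<Rightarrow> ('k, 'w::ab_group_add) vspace \<Rightarrow>
   ('k, 'u::ab_group_add) vspace \<Rightarrow> ('v \<Rightarrow> 'w \<Rightarrow> 'u) \<Rightarrow> bool"
where
  "bilinear_map V W U f \<longleftrightarrow>
     (\<forall>x\<in>carr V. linear_map W U (f x)) \<and> (\<forall>y\<in>carr W. linear_map V U (\<lambda>x. f x y))"

definition base_field :: "('k::field_char_0, 'k) vspace" where
  "base_field = \<lparr>carr = UNIV, smul = (*)\<rparr>"

definition pointwise :: "'k::field_char_0 \<Rightarrow> ('b \<Rightarrow> 'k) \<Rightarrow> 'b \<Rightarrow> 'k" where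
  "pointwise c f = (\<lambda>x. c * f x)"

text \<open>A functional on \<open>V\<close> is represented by the function that vanishes outside \<open>carr V\<close>, so that
  equal functionals are equal functions.\<close>

definition dual :: "('k::field_char_0, 'v::ab_group_add) vspace \<Rightarrow> ('k, 'v \<Rightarrow> 'k) vspace" where
  "dual V = \<lparr>carr = {\<phi>. linear_map V base_field \<phi> \<and> (\<forall>x. x \<notin> carr V \<longrightarrow> \<phi> x = 0)},
             smul = pointwise\<rparr>"

definition restr :: "('k::field_char_0, 'v::ab_group_add) vspace \<Rightarrow> ('v \<Rightarrow> 'k) \<Rightarrow> 'v \<Rightarrow> 'k" where
  "restr V f = (\<lambda>x. if x \<in> carr V then f x else 0)"


section \<open>Tensor products\<close>

text \<open>
  The quotient of the free vector space on \<open>V \<times> W\<close> by the bilinearity relations embeds into the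
  linear forms on the space of bilinear forms \<open>V \<times> W \<rightarrow> k\<close>, the class of \<open>(x, y)\<close> going to
  evaluation at \<open>(x, y)\<close>. The tensor product is taken to be the image of this embedding. In this
  way tensors live in a type of class \<open>ab_group_add\<close> and tensor products can be iterated.
  That this is the tensor product is the universal property, proved below as
  \<open>tensor_universal\<close>; the definitions after it use only \<open>tensor\<close>, \<open>tens\<close> and \<open>tensor_lift\<close>.
\<close>

definition tens ::
  "('k::field_char_0, 'v::ab_group_add) vspace \<Rightarrow> ('k, 'w::ab_group_add) vspace \<Rightarrow>
   'v \<Rightarrow> 'w \<Rightarrow> ('v \<Rightarrow> 'w \<Rightarrow> 'k) \<Rightarrow> 'k"
where
  "tens V W x y = (\<lambda>\<beta>. if bilinear_map V W base_field \<beta> then \<beta> x y else 0)"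

definition tensor ::
  "('k::field_char_0, 'v::ab_group_add) vspace \<Rightarrow> ('k, 'w::ab_group_add) vspace \<Rightarrow>
   ('k, ('v \<Rightarrow> 'w \<Rightarrow> 'k) \<Rightarrow> 'k) vspace"
where
  "tensor V W =
     \<lparr>carr = module.span pointwise {tens V W x y | x y. x \<in> carr V \<and> y \<in> carr W},
      smul = pointwise\<rparr>"

text \<open>For bilinear \<open>f\<close>, the linear map on \<open>V \<otimes> W\<close> that sends
  \<open>\<Sum> x\<^sub>i \<otimes> y\<^sub>i\<close> to \<open>\<Sum> f x\<^sub>i y\<^sub>i\<close>. With it, a Sweedler sum \<open>\<Sum> f x\<^sub>1 x\<^sub>2\<close>
  is \<open>tensor_lift V V f (\<Delta> x)\<close>.\<close>

definition tensor_lift ::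
  "('k::field_char_0, 'v::ab_group_add) vspace \<Rightarrow> ('k, 'w::ab_group_add) vspace \<Rightarrow>
   ('v \<Rightarrow> 'w \<Rightarrow> 'u::ab_group_add) \<Rightarrow> (('v \<Rightarrow> 'w \<Rightarrow> 'k) \<Rightarrow> 'k) \<Rightarrow> 'u"
where
  "tensor_lift V W f T =
     (THE u. \<exists>ps. set ps \<subseteq> carr V \<times> carr W \<and>
                  T = (\<Sum>(x, y)\<leftarrow>ps. tens V W x y) \<and>
                  u = (\<Sum>(x, y)\<leftarrow>ps. f x y))"

lemma vector_space_pointwise: "vector_space (pointwise :: 'k::field_char_0 \<Rightarrow> ('b \<Rightarrow> 'k) \<Rightarrow> 'b \<Rightarrow> 'k)"
  by unfold_locales (auto simp: pointwise_def fun_eq_iff algebra_simps)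

lemma vector_space_times: "vector_space ((*) :: 'k::field_char_0 \<Rightarrow> 'k \<Rightarrow> 'k)"
  by unfold_locales (auto simp: algebra_simps)

lemma is_vspace_tensor: "is_vspace (tensor V W)"
  by (simp add: is_vspace_def tensor_def vector_space_pointwise module.subspace_span module_iff_vector_space)

lemma is_vspace_base_field: "is_vspace (base_field :: ('k::field_char_0, 'k) vspace)"
proof -
  interpret P: vector_space "(*) :: 'k \<Rightarrow> 'k \<Rightarrow> 'k"
    by (rule vector_space_times)
  show ?thesis unfolding is_vspace_def base_field_def
    using P.subspace_UNIV vector_space_times by simp
qed

lemma is_vspaceD:
  assumes "is_vspace V"
  shows "0 \<in> carr V" "x \<in> carr V \<Longrightarrow> y \<in> carr V \<Longrightarrow> x + y \<in> carr V"
    "x \<in> carr V \<Longrightarrow> smul V c x \<in> carr V"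
    "smul V c (a + b) = smul V c a + smul V c b" "smul V c 0 = 0"
  using assms unfolding is_vspace_def module_iff_vector_space[symmetric]
  by (auto simp: module.subspace_def module.scale_right_distrib module.scale_zero_right)

lemma linear_map_0:
  assumes "is_vspace V" "linear_map V U g"
  shows "g 0 = 0"
proof -
  have "0 \<in> carr V" by (rule is_vspaceD[OF assms(1)])
  then have "g (0 + 0) = g 0 + g 0"
    using assms(2) unfolding linear_map_def by blast
  then show ?thesis by simp
qed

lemma tens_in_tensor: "x \<in> carr V \<Longrightarrow> y \<in> carr W \<Longrightarrow> tens V W x y \<in> carr (tensor V W)"
  unfolding tensor_def
  by (auto intro!: module.span_base simp: module_iff_vector_space vector_space_pointwise)

lemma smul_tens:
  assumes "x \<in> carr V" "y \<in> carr W"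
  shows "smul (tensor V W) c (tens V W x y) = tens V W (smul V c x) y"
  using assms
  by (auto simp: tensor_def pointwise_def tens_def fun_eq_iff bilinear_map_def linear_map_def base_field_def)

lemma bilinear_map_tens:
  assumes "is_vspace V" "is_vspace W"
  shows "bilinear_map V W (tensor V W) (tens V W)"
  using tens_in_tensor[of _ V _ W]
  unfolding bilinear_map_def[of V W "tensor V W"] linear_map_def
  by (auto simp: tensor_def pointwise_def tens_def fun_eq_iff bilinear_map_def linear_map_def base_field_def)

lemma tensor_decomp:
  assumes V: "is_vspace V" and T: "T \<in> carr (tensor V W)"
  shows "\<exists>ps. set ps \<subseteq> carr V \<times> carr W \<and> T = (\<Sum>(x, y)\<leftarrow>ps. tens V W x y)"
proof -
  have "T \<in> module.span pointwise {tens V W x y | x y. x \<in> carr V \<and> y \<in> carr W}"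
    using T by (simp add: tensor_def)
  then show ?thesis
  proof (rule module.span_induct_alt[OF vector_space_pointwise[unfolded module_iff_vector_space[symmetric]]])
    show "\<exists>ps. set ps \<subseteq> carr V \<times> carr W \<and> 0 = (\<Sum>(x, y)\<leftarrow>ps. tens V W x y)"
      by (rule exI[of _ "[]"]) simp
  next
    fix c S T
    assume "S \<in> {tens V W x y | x y. x \<in> carr V \<and> y \<in> carr W}"
    then obtain x y where S: "S = tens V W x y" "x \<in> carr V" "y \<in> carr W" by auto
    assume "\<exists>ps. set ps \<subseteq> carr V \<times> carr W \<and> T = (\<Sum>(x, y)\<leftarrow>ps. tens V W x y)"
    then obtain ps where ps: "set ps \<subseteq> carr V \<times> carr W" "T = (\<Sum>(x, y)\<leftarrow>ps. tens V W x y)"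
      by auto
    have "pointwise c S = tens V W (smul V c x) y"
      using smul_tens[OF S(2,3), of c] by (simp add: S(1) tensor_def)
    then show "\<exists>ps. set ps \<subseteq> carr V \<times> carr W \<and> pointwise c S + T = (\<Sum>(x, y)\<leftarrow>ps. tens V W x y)"
      using ps S is_vspaceD(3)[OF V] by (intro exI[of _ "(smul V c x, y) # ps"]) auto
  qed
qed

lemma tensor_sum_unique:
  assumes V: "is_vspace V" and W: "is_vspace W" and U: "is_vspace U" and f: "bilinear_map V W U f"
    and ps: "set ps \<subseteq> carr V \<times> carr W" and qs: "set qs \<subseteq> carr V \<times> carr W"
    and eq: "(\<Sum>(x, y)\<leftarrow>ps. tens V W x y) = (\<Sum>(x, y)\<leftarrow>qs. tens V W x y)"
  shows "(\<Sum>(x, y)\<leftarrow>ps. f x y) = (\<Sum>(x, y)\<leftarrow>qs. f x y)"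
proof (rule ccontr)
  let ?d = "(\<Sum>(x, y)\<leftarrow>ps. f x y) - (\<Sum>(x, y)\<leftarrow>qs. f x y)"
  assume "(\<Sum>(x, y)\<leftarrow>ps. f x y) \<noteq> (\<Sum>(x, y)\<leftarrow>qs. f x y)"
  then have d: "?d \<noteq> 0" by simp
  interpret P: vector_space_pair "smul U" "(*)"
    using U vector_space_times unfolding is_vspace_def vector_space_pair_def by simp
  have "P.vs1.independent {?d}" using d by (simp add: P.vs1.dependent_single)
  from P.linear_independent_extend[OF this, of "\<lambda>_. 1"] obtain \<chi>
    where \<chi>: "Vector_Spaces.linear (smul U) (*) \<chi>" "\<chi> ?d = 1" by auto
  interpret L: Vector_Spaces.linear "smul U" "(*)" \<chi> by (rule \<chi>(1))
  let ?b = "\<lambda>x y. \<chi> (f x y)"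
  have b: "bilinear_map V W base_field ?b"
    using f by (auto simp: bilinear_map_def linear_map_def base_field_def L.add L.scale)
  have ev: "(\<Sum>(x, y)\<leftarrow>rs. tens V W x y) ?b = \<chi> (\<Sum>(x, y)\<leftarrow>rs. f x y)" for rs
    by (induction rs) (auto simp: tens_def b L.add L.zero)
  have "\<chi> ?d = 0" using ev[of ps] ev[of qs] eq by (simp add: L.diff)
  with \<chi>(2) show False by simp
qed

lemma tensor_lift_sum:
  assumes "is_vspace V" "is_vspace W" "is_vspace U" "bilinear_map V W U f"
    and "set ps \<subseteq> carr V \<times> carr W"
  shows "tensor_lift V W f (\<Sum>(x, y)\<leftarrow>ps. tens V W x y) = (\<Sum>(x, y)\<leftarrow>ps. f x y)"
  unfolding tensor_lift_def
proof (rule the_equality)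
  show "\<exists>qs. set qs \<subseteq> carr V \<times> carr W \<and>
      (\<Sum>(x, y)\<leftarrow>ps. tens V W x y) = (\<Sum>(x, y)\<leftarrow>qs. tens V W x y) \<and>
      (\<Sum>(x, y)\<leftarrow>ps. f x y) = (\<Sum>(x, y)\<leftarrow>qs. f x y)"
    using assms(5) by blast
next
  fix u
  assume "\<exists>qs. set qs \<subseteq> carr V \<times> carr W \<and>
      (\<Sum>(x, y)\<leftarrow>ps. tens V W x y) = (\<Sum>(x, y)\<leftarrow>qs. tens V W x y) \<and>
      u = (\<Sum>(x, y)\<leftarrow>qs. f x y)"
  then show "u = (\<Sum>(x, y)\<leftarrow>ps. f x y)"
    using tensor_sum_unique[OF assms(1-5)] by auto
qed

theorem tensor_universal:
  assumes V: "is_vspace V" and W: "is_vspace W" and U: "is_vspace U" and f: "bilinear_map V W U f"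
  shows "linear_map (tensor V W) U (tensor_lift V W f)"
    and "\<And>x y. x \<in> carr V \<Longrightarrow> y \<in> carr W \<Longrightarrow> tensor_lift V W f (tens V W x y) = f x y"
    and "\<And>g T. linear_map (tensor V W) U g \<Longrightarrow>
           (\<And>x y. x \<in> carr V \<Longrightarrow> y \<in> carr W \<Longrightarrow> g (tens V W x y) = f x y) \<Longrightarrow>
           T \<in> carr (tensor V W) \<Longrightarrow> g T = tensor_lift V W f T"
proof -
  note lift = tensor_lift_sum[OF V W U f]
  show el: "tensor_lift V W f (tens V W x y) = f x y" if "x \<in> carr V" "y \<in> carr W" for x y
    using lift[of "[(x, y)]"] that by simp
  have inU: "(\<Sum>(x, y)\<leftarrow>ps. f x y) \<in> carr U" if "set ps \<subseteq> carr V \<times> carr W" for ps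
    using that f by (induction ps) (auto simp: is_vspaceD[OF U] bilinear_map_def linear_map_def)
  have sc: "smul (tensor V W) c (\<Sum>(x, y)\<leftarrow>ps. tens V W x y) =
              (\<Sum>(x, y)\<leftarrow>map (\<lambda>(x, y). (smul V c x, y)) ps. tens V W x y) \<and>
            smul U c (\<Sum>(x, y)\<leftarrow>ps. f x y) =
              (\<Sum>(x, y)\<leftarrow>map (\<lambda>(x, y). (smul V c x, y)) ps. f x y)"
    if "set ps \<subseteq> carr V \<times> carr W" for c ps
    using that f
    by (induction ps)
       (auto simp: is_vspaceD[OF is_vspace_tensor] is_vspaceD[OF U] smul_tens bilinear_map_def linear_map_def)
  show "linear_map (tensor V W) U (tensor_lift V W f)"
    unfolding linear_map_def
  proof (intro conjI ballI allI)
    fix T assume "T \<in> carr (tensor V W)"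
    from tensor_decomp[OF V this] obtain ps
      where ps: "set ps \<subseteq> carr V \<times> carr W" "T = (\<Sum>(x, y)\<leftarrow>ps. tens V W x y)" by auto
    show "tensor_lift V W f T \<in> carr U" using lift[OF ps(1)] inU[OF ps(1)] ps(2) by simp
  next
    fix S T assume "S \<in> carr (tensor V W)" "T \<in> carr (tensor V W)"
    from tensor_decomp[OF V this(1)] tensor_decomp[OF V this(2)] obtain ps qs
      where ps: "set ps \<subseteq> carr V \<times> carr W" "S = (\<Sum>(x, y)\<leftarrow>ps. tens V W x y)"
        and qs: "set qs \<subseteq> carr V \<times> carr W" "T = (\<Sum>(x, y)\<leftarrow>qs. tens V W x y)" by auto
    show "tensor_lift V W f (S + T) = tensor_lift V W f S + tensor_lift V W f T"
      using lift[OF ps(1)] lift[OF qs(1)] lift[of "ps @ qs"] ps qs by simp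
  next
    fix c T assume "T \<in> carr (tensor V W)"
    from tensor_decomp[OF V this] obtain ps
      where ps: "set ps \<subseteq> carr V \<times> carr W" "T = (\<Sum>(x, y)\<leftarrow>ps. tens V W x y)" by auto
    let ?qs = "map (\<lambda>(x, y). (smul V c x, y)) ps"
    have "set ?qs \<subseteq> carr V \<times> carr W" using ps(1) is_vspaceD(3)[OF V] by auto
    from lift[OF this] lift[OF ps(1)] sc[OF ps(1), of c] ps(2)
    show "tensor_lift V W f (smul (tensor V W) c T) = smul U c (tensor_lift V W f T)" by simp
  qed
  show "g T = tensor_lift V W f T"
    if g: "linear_map (tensor V W) U g"
      and gf: "\<And>x y. x \<in> carr V \<Longrightarrow> y \<in> carr W \<Longrightarrow> g (tens V W x y) = f x y"
      and T: "T \<in> carr (tensor V W)" for g T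
  proof -
    from tensor_decomp[OF V T] obtain ps
      where ps: "set ps \<subseteq> carr V \<times> carr W" "T = (\<Sum>(x, y)\<leftarrow>ps. tens V W x y)" by auto
    have "(\<Sum>(x, y)\<leftarrow>ps. tens V W x y) \<in> carr (tensor V W) \<and>
          g (\<Sum>(x, y)\<leftarrow>ps. tens V W x y) = (\<Sum>(x, y)\<leftarrow>ps. f x y)"
      using ps(1)
    proof (induction ps)
      case Nil
      then show ?case
        using linear_map_0[OF is_vspace_tensor g] is_vspaceD(1)[OF is_vspace_tensor, of V W]
        by (simp only: list.map sum_list.Nil)
    next
      case (Cons p ps)
      obtain x y where p: "p = (x, y)" "x \<in> carr V" "y \<in> carr W" using Cons.prems by auto
      let ?t = "tens V W x y" and ?S = "\<Sum>(x, y)\<leftarrow>ps. tens V W x y"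
      have t: "?t \<in> carr (tensor V W)" "g ?t = f x y"
        using tens_in_tensor[OF p(2,3)] gf[OF p(2,3)] by auto
      have S: "?S \<in> carr (tensor V W)" "g ?S = (\<Sum>(x, y)\<leftarrow>ps. f x y)"
        using Cons by auto
      have "g (?t + ?S) = g ?t + g ?S" using g t(1) S(1) unfolding linear_map_def by blast
      moreover have "?t + ?S \<in> carr (tensor V W)"
        by (rule is_vspaceD(2)[OF is_vspace_tensor t(1) S(1)])
      ultimately show ?case using t S by (simp only: p(1) list.map sum_list.Cons prod.case)
    qed
    then show ?thesis using lift[OF ps(1)] ps(2) by simp
  qed
qed

text \<open>The maps \<open>f \<otimes> g : V \<otimes> W \<rightarrow> V' \<otimes> W'\<close>, \<open>\<tau>\<close>, the identification
  \<open>(V \<otimes> V) \<otimes> V \<cong> V \<otimes> (V \<otimes> V)\<close>, and the factorwise product on \<open>V \<otimes> V\<close>.\<close>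

definition tensor_map where
  "tensor_map V W V' W' f g = tensor_lift V W (\<lambda>x y. tens V' W' (f x) (g y))"

definition tensor_flip where
  "tensor_flip V = tensor_lift V V (\<lambda>x y. tens V V y x)"

definition tensor_assoc where
  "tensor_assoc V =
     tensor_lift (tensor V V) V
       (\<lambda>t z. tensor_lift V V (\<lambda>x y. tens V (tensor V V) x (tens V V y z)) t)"

definition tensor_mult where
  "tensor_mult V \<mu> S T =
     tensor_lift V V (\<lambda>a b. tensor_lift V V (\<lambda>c d. tens V V (\<mu> a c) (\<mu> b d)) T) S"

text \<open>\<open>\<langle>\<phi> \<otimes> \<psi>, T\<rangle>\<close> for \<open>T \<in> V \<otimes> V\<close>.\<close>

definition tensor_pair where
  "tensor_pair V \<phi> \<psi> T = tensor_lift V V (\<lambda>x y. \<phi> x * \<psi> y) T"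


section \<open>Hom-bialgebras\<close>

definition hom_bialgebra ::
  "('k::field_char_0, 'v::ab_group_add) vspace \<Rightarrow> ('v \<Rightarrow> 'v \<Rightarrow> 'v) \<Rightarrow>
   ('v \<Rightarrow> ('v \<Rightarrow> 'v \<Rightarrow> 'k) \<Rightarrow> 'k) \<Rightarrow> ('v \<Rightarrow> 'v) \<Rightarrow> bool"
where
  "hom_bialgebra A \<mu> \<Delta> \<alpha> \<longleftrightarrow>
     is_vspace A \<and>
     bilinear_map A A A \<mu> \<and>
     linear_map A (tensor A A) \<Delta> \<and>
     linear_map A A \<alpha> \<and>
     (\<forall>x\<in>carr A. \<forall>y\<in>carr A. \<alpha> (\<mu> x y) = \<mu> (\<alpha> x) (\<alpha> y)) \<and>
     (\<forall>x\<in>carr A. \<forall>y\<in>carr A. \<forall>z\<in>carr A. \<mu> (\<alpha> x) (\<mu> y z) = \<mu> (\<mu> x y) (\<alpha> z)) \<and>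
     (\<forall>x\<in>carr A. tensor_map A A A A \<alpha> \<alpha> (\<Delta> x) = \<Delta> (\<alpha> x)) \<and>
     (\<forall>x\<in>carr A.
        tensor_map A A A (tensor A A) \<alpha> \<Delta> (\<Delta> x) =
        tensor_assoc A (tensor_map A A (tensor A A) A \<Delta> \<alpha> (\<Delta> x))) \<and>
     (\<forall>a\<in>carr A. \<forall>b\<in>carr A. \<Delta> (\<mu> a b) = tensor_mult A \<mu> (\<Delta> a) (\<Delta> b))"

text \<open>Structure maps \<open>\<Delta>\<^sup>*\<close>, \<open>\<mu>\<^sup>*\<close>, \<open>\<alpha>\<^sup>*\<close> of the dual. For finite
  dimensional \<open>A\<close>, \<open>dual_comult A \<mu> \<phi>\<close> is the unique \<open>T \<in> A\<^sup>* \<otimes> A\<^sup>*\<close> with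
  \<open>\<langle>T, x \<otimes> y\<rangle> = \<langle>\<phi>, \<mu> x y\<rangle>\<close>.\<close>

definition dual_mult ::
  "('k::field_char_0, 'v::ab_group_add) vspace \<Rightarrow> ('v \<Rightarrow> ('v \<Rightarrow> 'v \<Rightarrow> 'k) \<Rightarrow> 'k) \<Rightarrow>
   ('v \<Rightarrow> 'k) \<Rightarrow> ('v \<Rightarrow> 'k) \<Rightarrow> 'v \<Rightarrow> 'k"
where
  "dual_mult A \<Delta> \<phi> \<psi> = restr A (\<lambda>x. tensor_pair A \<phi> \<psi> (\<Delta> x))"

definition dual_comult ::
  "('k::field_char_0, 'v::ab_group_add) vspace \<Rightarrow> ('v \<Rightarrow> 'v \<Rightarrow> 'v) \<Rightarrow>
   ('v \<Rightarrow> 'k) \<Rightarrow> (('v \<Rightarrow> 'k) \<Rightarrow> ('v \<Rightarrow> 'k) \<Rightarrow> 'k) \<Rightarrow> 'k"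
where
  "dual_comult A \<mu> \<phi> =
     (THE T. T \<in> carr (tensor (dual A) (dual A)) \<and>
        (\<forall>x\<in>carr A. \<forall>y\<in>carr A.
           tensor_lift (dual A) (dual A) (\<lambda>\<xi> \<eta>. \<xi> x * \<eta> y) T = \<phi> (\<mu> x y)))"

definition dual_map ::
  "('k::field_char_0, 'v::ab_group_add) vspace \<Rightarrow> ('v \<Rightarrow> 'v) \<Rightarrow> ('v \<Rightarrow> 'k) \<Rightarrow> 'v \<Rightarrow> 'k"
where
  "dual_map A \<alpha> \<phi> = restr A (\<phi> \<circ> \<alpha>)"

text \<open>The element \<open>R \<in> A \<otimes> A\<close> as the linear form \<open>\<phi> \<otimes> \<psi> \<mapsto> \<langle>\<phi> \<otimes> \<psi>, R\<rangle>\<close> on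
  \<open>A\<^sup>* \<otimes> A\<^sup>*\<close>.\<close>

definition form_of ::
  "('k::field_char_0, 'v::ab_group_add) vspace \<Rightarrow> (('v \<Rightarrow> 'v \<Rightarrow> 'k) \<Rightarrow> 'k) \<Rightarrow>
   ((('v \<Rightarrow> 'k) \<Rightarrow> ('v \<Rightarrow> 'k) \<Rightarrow> 'k) \<Rightarrow> 'k) \<Rightarrow> 'k"
where
  "form_of A R = tensor_lift (dual A) (dual A) (\<lambda>\<phi> \<psi>. tensor_pair A \<phi> \<psi> R)"


section \<open>Braided and cobraided Hom-bialgebras\<close>

text \<open>\<open>R\<^sub>1\<^sub>3R\<^sub>2\<^sub>3\<close> lies in \<open>(A \<otimes> A) \<otimes> A\<close>, and \<open>R\<^sub>1\<^sub>3R\<^sub>1\<^sub>2\<close> lies in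
  \<open>A \<otimes> (A \<otimes> A)\<close>, matching the targets of \<open>\<Delta> \<otimes> \<alpha>\<close> and \<open>\<alpha> \<otimes> \<Delta>\<close>.\<close>

definition R13_R23 where
  "R13_R23 A \<mu> \<alpha> R =
     tensor_lift A A (\<lambda>s t. tensor_lift A A (\<lambda>s' t'.
       tens (tensor A A) A (tens A A (\<alpha> s) (\<alpha> s')) (\<mu> t t')) R) R"

definition R13_R12 where
  "R13_R12 A \<mu> \<alpha> R =
     tensor_lift A A (\<lambda>s t. tensor_lift A A (\<lambda>s' t'.
       tens A (tensor A A) (\<mu> s s') (tens A A (\<alpha> t') (\<alpha> t))) R) R"

definition braided_hom_bialgebra ::
  "('k::field_char_0, 'v::ab_group_add) vspace \<Rightarrow> ('v \<Rightarrow> 'v \<Rightarrow> 'v) \<Rightarrow>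
   ('v \<Rightarrow> ('v \<Rightarrow> 'v \<Rightarrow> 'k) \<Rightarrow> 'k) \<Rightarrow> ('v \<Rightarrow> 'v) \<Rightarrow>
   (('v \<Rightarrow> 'v \<Rightarrow> 'k) \<Rightarrow> 'k) \<Rightarrow> bool"
where
  "braided_hom_bialgebra A \<mu> \<Delta> \<alpha> R \<longleftrightarrow>
     hom_bialgebra A \<mu> \<Delta> \<alpha> \<and>
     R \<in> carr (tensor A A) \<and>
     tensor_map A A (tensor A A) A \<Delta> \<alpha> R = R13_R23 A \<mu> \<alpha> R \<and>
     tensor_map A A A (tensor A A) \<alpha> \<Delta> R = R13_R12 A \<mu> \<alpha> R \<and>
     (\<forall>x\<in>carr A. tensor_mult A \<mu> (tensor_flip A (\<Delta> x)) R = tensor_mult A \<mu> R (\<Delta> x))"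

definition cobraided_hom_bialgebra ::
  "('k::field_char_0, 'v::ab_group_add) vspace \<Rightarrow> ('v \<Rightarrow> 'v \<Rightarrow> 'v) \<Rightarrow>
   ('v \<Rightarrow> ('v \<Rightarrow> 'v \<Rightarrow> 'k) \<Rightarrow> 'k) \<Rightarrow> ('v \<Rightarrow> 'v) \<Rightarrow>
   ((('v \<Rightarrow> 'v \<Rightarrow> 'k) \<Rightarrow> 'k) \<Rightarrow> 'k) \<Rightarrow> bool"
where
  "cobraided_hom_bialgebra A \<mu> \<Delta> \<alpha> R \<longleftrightarrow>
     hom_bialgebra A \<mu> \<Delta> \<alpha> \<and>
     linear_map (tensor A A) base_field R \<and>
     (\<forall>x\<in>carr A. \<forall>y\<in>carr A. \<forall>z\<in>carr A.
        R (tens A A (\<mu> x y) (\<alpha> z)) =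
        tensor_lift A A (\<lambda>z1 z2. R (tens A A (\<alpha> x) z1) * R (tens A A (\<alpha> y) z2)) (\<Delta> z)) \<and>
     (\<forall>x\<in>carr A. \<forall>y\<in>carr A. \<forall>z\<in>carr A.
        R (tens A A (\<alpha> x) (\<mu> y z)) =
        tensor_lift A A (\<lambda>x1 x2. R (tens A A x1 (\<alpha> z)) * R (tens A A x2 (\<alpha> y))) (\<Delta> x)) \<and>
     (\<forall>x\<in>carr A. \<forall>y\<in>carr A.
        tensor_lift A A (\<lambda>x1 x2. tensor_lift A A (\<lambda>y1 y2.
          smul A (R (tens A A x2 y2)) (\<mu> y1 x1)) (\<Delta> y)) (\<Delta> x) =
        tensor_lift A A (\<lambda>x1 x2. tensor_lift A A (\<lambda>y1 y2.
          smul A (R (tens A A x1 y1)) (\<mu> x2 y2)) (\<Delta> y)) (\<Delta> x))"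

end

theory Submission
  imports Defs
begin

text \<open>
  Every condition on one side is the transpose of a condition on the other side. An equation
  between elements of \<open>A \<otimes> A\<close> or \<open>A \<otimes> A \<otimes> A\<close> holds iff it holds after pairing with all
  \<open>\<phi> \<otimes> \<psi>\<close> or \<open>\<phi> \<otimes> \<psi> \<otimes> \<chi>\<close>, because \<open>A\<close> has finite dimension, and pairing moves each
  structure map of \<open>A\<close> to the corresponding structure map of \<open>A\<^sup>*\<close>. With
  \<open>R = \<Sum> s\<^sub>i \<otimes> t\<^sub>i\<close> and a Sweedler sum for \<open>\<mu>\<^sup>*(\<chi>)\<close>,

  \<^item> \<open>R(\<phi>\<psi> \<otimes> \<alpha>\<^sup>*\<chi>) = \<langle>\<phi> \<otimes> \<psi> \<otimes> \<chi>, (\<Delta> \<otimes> \<alpha>)(R)\<rangle>\<close>, and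
    \<open>\<Sum> R(\<alpha>\<^sup>*\<phi> \<otimes> \<chi>\<^sub>1) R(\<alpha>\<^sup>*\<psi> \<otimes> \<chi>\<^sub>2) = \<Sum> \<phi>(\<alpha> s\<^sub>i) \<psi>(\<alpha> s\<^sub>j) \<chi>(t\<^sub>i t\<^sub>j)
      = \<langle>\<phi> \<otimes> \<psi> \<otimes> \<chi>, R\<^sub>1\<^sub>3R\<^sub>2\<^sub>3\<rangle>\<close>;
  \<^item> symmetrically, the second axiom of a cobraiding compares the values of
    \<open>\<phi> \<otimes> \<psi> \<otimes> \<chi>\<close> on \<open>(\<alpha> \<otimes> \<Delta>)(R)\<close> and on \<open>R\<^sub>1\<^sub>3R\<^sub>1\<^sub>2\<close>;
  \<^item> the two sides of the third axiom for \<open>\<phi>, \<psi>\<close>, evaluated at \<open>z\<close>, are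
    \<open>\<langle>\<phi> \<otimes> \<psi>, \<tau>(\<Delta> z) R\<rangle>\<close> and \<open>\<langle>\<phi> \<otimes> \<psi>, R \<Delta>(z)\<rangle>\<close>.

  These three comparisons are \<open>braid_comult_left_iff\<close>, \<open>braid_comult_right_iff\<close> and
  \<open>braid_commute_iff\<close>. The cobraided side also asks that \<open>A\<^sup>*\<close> be a Hom-bialgebra, and this is
  \<open>hom_bialgebra_dual\<close>. Invariance of \<open>R\<close> under \<open>\<alpha> \<otimes> \<alpha>\<close> transposes in the same way, in
  \<open>twist_invariant_iff\<close>.

  Nondegeneracy of the pairings comes from frames: finite families \<open>e\<^sub>i\<close> of vectors and
  \<open>f\<^sub>i\<close> of functionals with \<open>x = \<Sum> f\<^sub>i(x) e\<^sub>i\<close> for all \<open>x\<close>. A space with a frame has its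
  elements separated by the \<open>f\<^sub>i\<close>, and frames pass to tensor products and to duals, so that the
  separating functionals on an iterated tensor product are products of functionals on the factors.
\<close>


section \<open>Finite sums\<close>

lemma sum_fun_apply: "(\<Sum>i\<in>I. F i) x = (\<Sum>i\<in>I. F i x)" for F :: "'i \<Rightarrow> 'b \<Rightarrow> 'c::comm_monoid_add"
  by (induction I rule: infinite_finite_induct) auto

text \<open>The index shared by two factors is contracted: this is how the two values of \<open>R\<close> in the first
two axioms of a cobraiding, summed over the components of a coproduct in the dual, become the
value of one functional on a product in \<open>A\<close>.\<close>

lemma sum_mult_contract:
  fixes a b :: "nat \<Rightarrow> 'a::comm_semiring_0"
  shows "(\<Sum>k<m. (\<Sum>i<n. a i * p k i) * (\<Sum>j<n. b j * q k j))
    = (\<Sum>i<n. \<Sum>j<n. a i * b j * (\<Sum>k<(m::nat). p k i * q k j))"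
proof -
  let ?z = "\<lambda>k i j. a i * b j * (p k i * q k j)"
  have "(\<Sum>k<m. (\<Sum>i<n. a i * p k i) * (\<Sum>j<n. b j * q k j)) = (\<Sum>k<m. \<Sum>i<n. \<Sum>j<n. ?z k i j)"
    by (simp add: sum_product mult_ac)
  also have "\<dots> = (\<Sum>i<n. \<Sum>k<m. \<Sum>j<n. ?z k i j)"
    by (rule sum.swap)
  also have "\<dots> = (\<Sum>i<n. \<Sum>j<n. \<Sum>k<m. ?z k i j)"
    by (intro sum.cong refl sum.swap)
  finally show ?thesis by (simp add: sum_distrib_left)
qed

text \<open>The middle-four interchange of \<open>(X \<otimes> X) \<otimes> (X \<otimes> X)\<close> in coordinates. It is what is left of the
compatibility of products and coproducts, and of the commutation axiom, after all tensors are
written as sums of pure tensors.\<close>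

lemma sum_swap_middle:
  fixes P Q X Y :: "nat \<Rightarrow> nat \<Rightarrow> 'a::comm_semiring_0"
  shows "(\<Sum>g<k. \<Sum>h<l. (\<Sum>i<m. P i g * Q i h) * (\<Sum>j<n. X j g * Y j h))
    = (\<Sum>i<m. \<Sum>j<n. (\<Sum>g<k. P i g * X j g) * (\<Sum>h<l. Q i h * Y j h))"
proof -
  let ?z = "\<lambda>i j g h. (P i g * X j g) * (Q i h * Y j h)"
  have "(\<Sum>g<k. \<Sum>h<l. (\<Sum>i<m. P i g * Q i h) * (\<Sum>j<n. X j g * Y j h))
    = (\<Sum>g<k. \<Sum>h<l. \<Sum>i<m. \<Sum>j<n. ?z i j g h)"
    by (simp add: sum_product mult_ac)
  also have "\<dots> = (\<Sum>g<k. \<Sum>i<m. \<Sum>h<l. \<Sum>j<n. ?z i j g h)"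
    by (intro sum.cong refl sum.swap)
  also have "\<dots> = (\<Sum>g<k. \<Sum>i<m. \<Sum>j<n. \<Sum>h<l. ?z i j g h)"
    by (intro sum.cong refl sum.swap)
  also have "\<dots> = (\<Sum>i<m. \<Sum>g<k. \<Sum>j<n. \<Sum>h<l. ?z i j g h)"
    by (rule sum.swap)
  also have "\<dots> = (\<Sum>i<m. \<Sum>j<n. \<Sum>g<k. \<Sum>h<l. ?z i j g h)"
    by (intro sum.cong refl sum.swap)
  also have "\<dots> = (\<Sum>i<m. \<Sum>j<n. (\<Sum>g<k. P i g * X j g) * (\<Sum>h<l. Q i h * Y j h))"
    by (simp add: sum_product)
  finally show ?thesis .
qed


section \<open>Linear and bilinear maps\<close>

lemma linear_mapI:
  assumes "\<And>x. x \<in> carr V \<Longrightarrow> f x \<in> carr W"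
    and "\<And>x y. x \<in> carr V \<Longrightarrow> y \<in> carr V \<Longrightarrow> f (x + y) = f x + f y"
    and "\<And>c x. x \<in> carr V \<Longrightarrow> f (smul V c x) = smul W c (f x)"
  shows "linear_map V W f"
  using assms by (auto simp: linear_map_def)

lemma linear_mapD:
  assumes "linear_map V W f" "x \<in> carr V"
  shows "f x \<in> carr W" "y \<in> carr V \<Longrightarrow> f (x + y) = f x + f y" "f (smul V c x) = smul W c (f x)"
  using assms by (auto simp: linear_map_def)

lemma linear_map_cong:
  assumes "is_vspace V" "\<And>x. x \<in> carr V \<Longrightarrow> f x = g x" "linear_map V W g"
  shows "linear_map V W f"
  using assms is_vspaceD(2,3)[OF assms(1)] by (auto simp: linear_map_def)

lemma linear_map_compose:
  assumes "linear_map V W g" "linear_map W U f"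
  shows "linear_map V U (\<lambda>x. f (g x))"
  using assms by (auto simp: linear_map_def)

lemma bilinear_mapI:
  assumes "\<And>x. x \<in> carr V \<Longrightarrow> linear_map W U (\<lambda>y. f x y)"
    and "\<And>y. y \<in> carr W \<Longrightarrow> linear_map V U (\<lambda>x. f x y)"
  shows "bilinear_map V W U f"
  using assms by (auto simp: bilinear_map_def)

lemma bilinear_mapD:
  assumes "bilinear_map V W U f"
  shows "x \<in> carr V \<Longrightarrow> linear_map W U (f x)" "y \<in> carr W \<Longrightarrow> linear_map V U (\<lambda>x. f x y)"
    "x \<in> carr V \<Longrightarrow> y \<in> carr W \<Longrightarrow> f x y \<in> carr U"
  using assms by (auto simp: bilinear_map_def linear_map_def)

lemma bilinear_left:
  assumes "bilinear_map V W U f" "linear_map Z V g" "y \<in> carr W"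
  shows "linear_map Z U (\<lambda>z. f (g z) y)"
  using linear_map_compose[OF assms(2) bilinear_mapD(2)[OF assms(1,3)]] .

lemma bilinear_right:
  assumes "bilinear_map V W U f" "linear_map Z W g" "x \<in> carr V"
  shows "linear_map Z U (\<lambda>z. f x (g z))"
  using linear_map_compose[OF assms(2) bilinear_mapD(1)[OF assms(1,3)]] .

lemma linear_map_id: "linear_map V V (\<lambda>x. x)"
  by (simp add: linear_map_def)

lemma smul_base_field [simp]: "smul base_field c x = c * x"
  by (simp add: base_field_def)

lemma carr_base_field [simp]: "x \<in> carr base_field"
  by (simp add: base_field_def)

lemma linear_mult_left: "linear_map V base_field f \<Longrightarrow> linear_map V base_field (\<lambda>x. f x * c)"
  by (auto simp: linear_map_def base_field_def algebra_simps)

lemma linear_mult_right: "linear_map V base_field f \<Longrightarrow> linear_map V base_field (\<lambda>x. c * f x)"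
  by (auto simp: linear_map_def base_field_def algebra_simps)

lemma is_vspace_scale:
  assumes "is_vspace V"
  shows "smul V (a + b) x = smul V a x + smul V b x" "smul V a (smul V b x) = smul V (a * b) x"
    "smul V 1 x = x" "smul V 0 x = 0"
proof -
  interpret vector_space "smul V" using assms by (simp add: is_vspace_def)
  show "smul V (a + b) x = smul V a x + smul V b x" "smul V a (smul V b x) = smul V (a * b) x"
    "smul V 1 x = x" "smul V 0 x = 0"
    by (simp_all add: scale_left_distrib)
qed

lemma sum_in_carr:
  assumes "is_vspace V" "\<And>i. i \<in> I \<Longrightarrow> x i \<in> carr V"
  shows "(\<Sum>i\<in>I. x i) \<in> carr V"
  using assms(2)
  by (induction I rule: infinite_finite_induct) (auto simp: is_vspaceD[OF assms(1)])

lemma linear_map_sum_arg: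
  assumes "is_vspace V" "linear_map V U f" "\<And>i. i \<in> I \<Longrightarrow> x i \<in> carr V"
  shows "f (\<Sum>i\<in>I. x i) = (\<Sum>i\<in>I. f (x i))"
  using assms(3)
proof (induction I rule: infinite_finite_induct)
  case (insert i I)
  then show ?case
    using linear_mapD(2)[OF assms(2), of "x i" "\<Sum>i\<in>I. x i"] sum_in_carr[OF assms(1), of I x] by simp
qed (simp_all add: linear_map_0[OF assms(1,2)])

lemma linear_map_double_sum_arg:
  assumes "is_vspace V" "linear_map V U f" "\<And>i j. i \<in> I \<Longrightarrow> j \<in> J \<Longrightarrow> x i j \<in> carr V"
  shows "f (\<Sum>i\<in>I. \<Sum>j\<in>J. x i j) = (\<Sum>i\<in>I. \<Sum>j\<in>J. f (x i j))"
proof -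
  have "f (\<Sum>i\<in>I. \<Sum>j\<in>J. x i j) = (\<Sum>i\<in>I. f (\<Sum>j\<in>J. x i j))"
    by (intro linear_map_sum_arg[OF assms(1,2)] sum_in_carr assms)
  then show ?thesis by (simp add: linear_map_sum_arg[OF assms(1,2)] assms(3))
qed

lemma linear_sum:
  assumes U: "is_vspace U" and f: "\<And>i. i \<in> I \<Longrightarrow> linear_map V U (f i)"
  shows "linear_map V U (\<lambda>x. \<Sum>i\<in>I. f i x)"
  using f
proof (induction I rule: infinite_finite_induct)
  case (insert i I)
  then show ?case
    using is_vspaceD[OF U] by (auto simp: linear_map_def algebra_simps)
qed (auto simp: linear_map_def is_vspaceD[OF U])

lemma linear_smul_vector:
  assumes U: "is_vspace U" and f: "linear_map V base_field f" and u: "u \<in> carr U"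
  shows "linear_map V U (\<lambda>x. smul U (f x) u)"
  using linear_mapD[OF f] u by (intro linear_mapI) (auto simp: is_vspaceD[OF U] is_vspace_scale[OF U])

lemma linear_smul_scalar:
  assumes U: "is_vspace U" and f: "linear_map V U f"
  shows "linear_map V U (\<lambda>x. smul U c (f x))"
  using linear_mapD[OF f]
  by (intro linear_mapI) (auto simp: is_vspaceD[OF U] is_vspace_scale[OF U] mult.commute)

lemma linear_tens_left:
  assumes "is_vspace V" "is_vspace W" "linear_map Z V f" "y \<in> carr W"
  shows "linear_map Z (tensor V W) (\<lambda>z. tens V W (f z) y)"
  using bilinear_left[OF bilinear_map_tens[OF assms(1,2)] assms(3,4)] .

lemma linear_tens_right:
  assumes "is_vspace V" "is_vspace W" "linear_map Z W f" "x \<in> carr V"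
  shows "linear_map Z (tensor V W) (\<lambda>z. tens V W x (f z))"
  using bilinear_right[OF bilinear_map_tens[OF assms(1,2)] assms(3,4)] .


section \<open>Sweedler sums\<close>

lemma tensor_decomp_sum:
  assumes V: "is_vspace V" and W: "is_vspace W" and T: "T \<in> carr (tensor V W)"
  shows "\<exists>(n :: nat) x y. (\<forall>i. x i \<in> carr V) \<and> (\<forall>i. y i \<in> carr W) \<and>
    T = (\<Sum>i<n. tens V W (x i) (y i))"
proof -
  from tensor_decomp[OF V T] obtain ps
    where ps: "set ps \<subseteq> carr V \<times> carr W" "T = (\<Sum>(x, y)\<leftarrow>ps. tens V W x y)" by auto
  \<comment> \<open>Padding with \<open>0\<close> makes the membership facts unconditional in \<open>i\<close>.\<close>
  let ?x = "\<lambda>i. if i < length ps then fst (ps ! i) else 0"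
  let ?y = "\<lambda>i. if i < length ps then snd (ps ! i) else 0"
  have nth: "ps ! i \<in> carr V \<times> carr W" if "i < length ps" for i
    using ps(1) that nth_mem by blast
  show ?thesis
  proof (intro exI conjI allI)
    show "?x i \<in> carr V" "?y i \<in> carr W" for i
      using nth[of i] is_vspaceD(1)[OF V] is_vspaceD(1)[OF W] by (auto simp: mem_Times_iff)
    show "T = (\<Sum>i<length ps. tens V W (?x i) (?y i))"
      unfolding ps(2) by (simp add: sum_list_sum_nth atLeast0LessThan case_prod_unfold)
  qed
qed

lemma tensor_lift_tens_sum:
  assumes V: "is_vspace V" and W: "is_vspace W" and U: "is_vspace U" and f: "bilinear_map V W U f"
    and xy: "\<And>i. x i \<in> carr V" "\<And>i. y i \<in> carr W"
  shows "tensor_lift V W f (\<Sum>i<n. tens V W (x i) (y i)) = (\<Sum>i<(n::nat). f (x i) (y i))"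
proof -
  have "tensor_lift V W f (\<Sum>i<n. tens V W (x i) (y i))
      = (\<Sum>i<n. tensor_lift V W f (tens V W (x i) (y i)))"
    by (intro linear_map_sum_arg[OF is_vspace_tensor tensor_universal(1)[OF V W U f]] tens_in_tensor xy)
  then show ?thesis by (simp add: tensor_universal(2)[OF V W U f] xy)
qed

lemma tensor_lift_cong:
  assumes "\<And>x y. x \<in> carr V \<Longrightarrow> y \<in> carr W \<Longrightarrow> f x y = g x y"
  shows "tensor_lift V W f T = tensor_lift V W g T"
proof -
  have "(\<Sum>(x, y)\<leftarrow>ps. f x y) = (\<Sum>(x, y)\<leftarrow>ps. g x y)" if "set ps \<subseteq> carr V \<times> carr W" for ps
    using that assms by (intro arg_cong[of _ _ sum_list] map_cong) auto
  then show ?thesis unfolding tensor_lift_def by (metis (no_types, lifting))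
qed

lemma linear_ext_tens:
  assumes V: "is_vspace V" and W: "is_vspace W" and U: "is_vspace U"
    and g: "linear_map (tensor V W) U g" and h: "linear_map (tensor V W) U h"
    and eq: "\<And>x y. x \<in> carr V \<Longrightarrow> y \<in> carr W \<Longrightarrow> g (tens V W x y) = h (tens V W x y)"
    and T: "T \<in> carr (tensor V W)"
  shows "g T = h T"
proof -
  have "bilinear_map V W U (\<lambda>x y. h (tens V W x y))"
    by (intro bilinear_mapI linear_map_compose[OF _ h] linear_tens_left linear_tens_right
        V W linear_map_id)
  from tensor_universal(3)[OF V W U this g eq T] tensor_universal(3)[OF V W U this h _ T]
  show ?thesis by simp
qed

text \<open>A Sweedler sum over a fixed tensor is linear in any parameter on which its summand depends
linearly; this supplies the outer bilinearity of nested Sweedler sums.\<close>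

lemma linear_lift_param:
  assumes Z: "is_vspace Z" and V: "is_vspace V" and W: "is_vspace W" and U: "is_vspace U"
    and T: "T \<in> carr (tensor V W)"
    and b: "\<And>z. z \<in> carr Z \<Longrightarrow> bilinear_map V W U (F z)"
    and l: "\<And>x y. x \<in> carr V \<Longrightarrow> y \<in> carr W \<Longrightarrow> linear_map Z U (\<lambda>z. F z x y)"
  shows "linear_map Z U (\<lambda>z. tensor_lift V W (F z) T)"
proof -
  obtain n x y where xy: "\<And>i. x i \<in> carr V" "\<And>i. y i \<in> carr W"
    "T = (\<Sum>i<(n::nat). tens V W (x i) (y i))"
    using tensor_decomp_sum[OF V W T] by blast
  show ?thesis
  proof (rule linear_map_cong[OF Z])
    show "tensor_lift V W (F z) T = (\<Sum>i<n. F z (x i) (y i))" if "z \<in> carr Z" for z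
      unfolding xy(3) by (rule tensor_lift_tens_sum[OF V W U b[OF that] xy(1,2)])
    show "linear_map Z U (\<lambda>z. \<Sum>i<n. F z (x i) (y i))"
      by (intro linear_sum U l xy)
  qed
qed

text \<open>The form in which nested Sweedler sums are evaluated. It serves the factorwise product,
\<open>R\<^sub>1\<^sub>3R\<^sub>2\<^sub>3\<close>, \<open>R\<^sub>1\<^sub>3R\<^sub>1\<^sub>2\<close> and both sides of the commutation axiom of a cobraiding alike,
since each of them is linear in each of its four slots.\<close>

lemma tensor_lift_lift_tens_sum:
  assumes V: "is_vspace V" and W: "is_vspace W" and V': "is_vspace V'" and W': "is_vspace W'"
    and U: "is_vspace U"
    and F1: "\<And>b c d. b \<in> carr W \<Longrightarrow> c \<in> carr V' \<Longrightarrow> d \<in> carr W' \<Longrightarrow> linear_map V U (\<lambda>a. F a b c d)"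
    and F2: "\<And>a c d. a \<in> carr V \<Longrightarrow> c \<in> carr V' \<Longrightarrow> d \<in> carr W' \<Longrightarrow> linear_map W U (\<lambda>b. F a b c d)"
    and F3: "\<And>a b d. a \<in> carr V \<Longrightarrow> b \<in> carr W \<Longrightarrow> d \<in> carr W' \<Longrightarrow> linear_map V' U (\<lambda>c. F a b c d)"
    and F4: "\<And>a b c. a \<in> carr V \<Longrightarrow> b \<in> carr W \<Longrightarrow> c \<in> carr V' \<Longrightarrow> linear_map W' U (\<lambda>d. F a b c d)"
    and ab: "\<And>i. a i \<in> carr V" "\<And>i. b i \<in> carr W"
    and cd: "\<And>j. c j \<in> carr V'" "\<And>j. d j \<in> carr W'"
  shows "tensor_lift V W (\<lambda>a b. tensor_lift V' W' (F a b) (\<Sum>j<n. tens V' W' (c j) (d j)))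
      (\<Sum>i<m. tens V W (a i) (b i))
    = (\<Sum>i<(m::nat). \<Sum>j<(n::nat). F (a i) (b i) (c j) (d j))"
proof -
  let ?T = "\<Sum>j<n. tens V' W' (c j) (d j)"
  have T: "?T \<in> carr (tensor V' W')"
    by (intro sum_in_carr is_vspace_tensor tens_in_tensor cd)
  have inner: "bilinear_map V' W' U (F x y)" if "x \<in> carr V" "y \<in> carr W" for x y
    using F3 F4 that by (intro bilinear_mapI)
  have outer: "bilinear_map V W U (\<lambda>x y. tensor_lift V' W' (F x y) ?T)"
    by (intro bilinear_mapI linear_lift_param V W V' W' U T inner F1 F2)
  have "tensor_lift V W (\<lambda>a b. tensor_lift V' W' (F a b) ?T) (\<Sum>i<m. tens V W (a i) (b i))
    = (\<Sum>i<m. tensor_lift V' W' (F (a i) (b i)) ?T)"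
    by (rule tensor_lift_tens_sum[OF V W U outer ab])
  also have "\<dots> = (\<Sum>i<m. \<Sum>j<n. F (a i) (b i) (c j) (d j))"
    by (rule sum.cong[OF refl]) (rule tensor_lift_tens_sum[OF V' W' U inner[OF ab] cd])
  finally show ?thesis .
qed

lemma linear_tensor_lift:
  assumes V: "is_vspace V" and W: "is_vspace W" and U: "is_vspace U" and U': "is_vspace U'"
    and f: "bilinear_map V W U f" and g: "linear_map U U' g" and T: "T \<in> carr (tensor V W)"
  shows "g (tensor_lift V W f T) = tensor_lift V W (\<lambda>x y. g (f x y)) T"
proof (rule linear_ext_tens[OF V W U' _ _ _ T])
  have b: "bilinear_map V W U' (\<lambda>x y. g (f x y))"
    using bilinear_mapD(1,2)[OF f] by (intro bilinear_mapI linear_map_compose[OF _ g])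
  show "linear_map (tensor V W) U' (\<lambda>T. g (tensor_lift V W f T))"
    by (intro linear_map_compose[OF _ g] tensor_universal(1) V W U f)
  show "linear_map (tensor V W) U' (tensor_lift V W (\<lambda>x y. g (f x y)))"
    by (intro tensor_universal(1) V W U' b)
  show "g (tensor_lift V W f (tens V W x y)) = tensor_lift V W (\<lambda>x y. g (f x y)) (tens V W x y)"
    if "x \<in> carr V" "y \<in> carr W" for x y
    by (simp add: tensor_universal(2)[OF V W U f that] tensor_universal(2)[OF V W U' b that])
qed


section \<open>Tensor products of functionals\<close>

text \<open>The functional \<open>f \<otimes> g\<close>. Unlike \<open>tensor_pair\<close>, it allows two different spaces and can therefore be
iterated: \<open>\<phi> \<otimes> \<psi> \<otimes> \<chi>\<close> on \<open>(V \<otimes> V) \<otimes> V\<close> is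
\<open>tensor_form (tensor V V) V (tensor_form V V \<phi> \<psi>) \<chi>\<close>.\<close>

definition tensor_form where
  "tensor_form V W f g = tensor_lift V W (\<lambda>x y. f x * g y)"

lemma tensor_pair_eq: "tensor_pair V \<phi> \<psi> T = tensor_form V V \<phi> \<psi> T"
  by (simp add: tensor_pair_def tensor_form_def)

lemma tensor_form_cong:
  assumes "\<And>x. x \<in> carr V \<Longrightarrow> f x = f' x" "\<And>y. y \<in> carr W \<Longrightarrow> g y = g' y"
  shows "tensor_form V W f g T = tensor_form V W f' g' T"
  unfolding tensor_form_def by (rule tensor_lift_cong) (simp add: assms)

context
  fixes V :: "('k::field_char_0, 'v::ab_group_add) vspace"
    and W :: "('k, 'w::ab_group_add) vspace"
  assumes V: "is_vspace V" and W: "is_vspace W"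
begin

lemma bilinear_mult:
  assumes "linear_map V base_field f" "linear_map W base_field g"
  shows "bilinear_map V W base_field (\<lambda>x y. f x * g y)"
  using assms by (intro bilinear_mapI linear_mult_left linear_mult_right)

lemma linear_tensor_form:
  assumes "linear_map V base_field f" "linear_map W base_field g"
  shows "linear_map (tensor V W) base_field (tensor_form V W f g)"
  unfolding tensor_form_def
  by (intro tensor_universal(1) V W is_vspace_base_field bilinear_mult assms)

lemma tensor_form_tens:
  assumes "linear_map V base_field f" "linear_map W base_field g" "x \<in> carr V" "y \<in> carr W"
  shows "tensor_form V W f g (tens V W x y) = f x * g y"
  unfolding tensor_form_def
  by (intro tensor_universal(2)[OF V W is_vspace_base_field] bilinear_mult assms)

lemma tensor_form_tens_sum:
  assumes "linear_map V base_field f" "linear_map W base_field g"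
    "\<And>i. x i \<in> carr V" "\<And>i. y i \<in> carr W"
  shows "tensor_form V W f g (\<Sum>i<n. tens V W (x i) (y i)) = (\<Sum>i<(n::nat). f (x i) * g (y i))"
  unfolding tensor_form_def
  by (intro tensor_lift_tens_sum[OF V W is_vspace_base_field] bilinear_mult assms)

lemma linear_tensor_form_first:
  assumes "is_vspace Z" "\<And>x. x \<in> carr V \<Longrightarrow> linear_map Z base_field (\<lambda>z. f z x)"
    "\<And>z. z \<in> carr Z \<Longrightarrow> linear_map V base_field (f z)" "linear_map W base_field g"
    "T \<in> carr (tensor V W)"
  shows "linear_map Z base_field (\<lambda>z. tensor_form V W (f z) g T)"
  unfolding tensor_form_def
  by (intro linear_lift_param assms V W is_vspace_base_field bilinear_mult linear_mult_left)

lemma linear_tensor_form_second: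
  assumes "is_vspace Z" "\<And>y. y \<in> carr W \<Longrightarrow> linear_map Z base_field (\<lambda>z. g z y)"
    "\<And>z. z \<in> carr Z \<Longrightarrow> linear_map W base_field (g z)" "linear_map V base_field f"
    "T \<in> carr (tensor V W)"
  shows "linear_map Z base_field (\<lambda>z. tensor_form V W f (g z) T)"
  unfolding tensor_form_def
  by (intro linear_lift_param assms V W is_vspace_base_field bilinear_mult linear_mult_right)

end

lemma bilinear_tens_map:
  assumes V': "is_vspace V'" and W': "is_vspace W'"
    and p: "linear_map V V' p" and q: "linear_map W W' q"
  shows "bilinear_map V W (tensor V' W') (\<lambda>x y. tens V' W' (p x) (q y))"
  using linear_mapD(1)[OF p] linear_mapD(1)[OF q]
  by (intro bilinear_mapI linear_tens_left linear_tens_right V' W' p q)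

lemma linear_tensor_map:
  assumes "is_vspace V" "is_vspace W" "is_vspace V'" "is_vspace W'"
    "linear_map V V' p" "linear_map W W' q"
  shows "linear_map (tensor V W) (tensor V' W') (tensor_map V W V' W' p q)"
  unfolding tensor_map_def
  by (intro tensor_universal(1) bilinear_tens_map is_vspace_tensor assms)

text \<open>Transposition of a tensor product of maps. This identity moves \<open>\<alpha> \<otimes> \<Delta>\<close>, \<open>\<Delta> \<otimes> \<alpha>\<close> and
\<open>\<alpha> \<otimes> \<alpha>\<close> from tensors to functionals, so that (co)associativity transposes without
any decomposition of tensors.\<close>

lemma tensor_form_tensor_map:
  assumes V: "is_vspace V" and W: "is_vspace W" and V': "is_vspace V'" and W': "is_vspace W'"
    and p: "linear_map V V' p" and q: "linear_map W W' q"
    and f: "linear_map V' base_field f" and g: "linear_map W' base_field g"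
    and T: "T \<in> carr (tensor V W)"
  shows "tensor_form V' W' f g (tensor_map V W V' W' p q T)
    = tensor_form V W (\<lambda>x. f (p x)) (\<lambda>y. g (q y)) T"
proof -
  have "tensor_form V' W' f g (tensor_map V W V' W' p q T)
    = tensor_lift V W (\<lambda>x y. tensor_form V' W' f g (tens V' W' (p x) (q y))) T"
    unfolding tensor_map_def
    by (intro linear_tensor_lift[OF V W is_vspace_tensor is_vspace_base_field
          bilinear_tens_map[OF V' W' p q] linear_tensor_form[OF V' W' f g] T])
  also have "\<dots> = tensor_lift V W (\<lambda>x y. f (p x) * g (q y)) T"
    by (intro tensor_lift_cong tensor_form_tens V' W' f g linear_mapD(1)[OF p] linear_mapD(1)[OF q])
  finally show ?thesis by (simp add: tensor_form_def)
qed

lemma linear_tensor_assoc: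
  assumes V: "is_vspace V"
  shows "linear_map (tensor (tensor V V) V) (tensor V (tensor V V)) (tensor_assoc V)"
    and "\<lbrakk>x \<in> carr V; y \<in> carr V; z \<in> carr V\<rbrakk> \<Longrightarrow>
      tensor_assoc V (tens (tensor V V) V (tens V V x y) z) = tens V (tensor V V) x (tens V V y z)"
proof -
  have b1: "bilinear_map V V (tensor V (tensor V V)) (\<lambda>x y. tens V (tensor V V) x (tens V V y z))"
    if "z \<in> carr V" for z
    using that by (intro bilinear_mapI linear_tens_left linear_tens_right V is_vspace_tensor
        tens_in_tensor linear_map_id)
  have b2: "bilinear_map (tensor V V) V (tensor V (tensor V V))
      (\<lambda>t z. tensor_lift V V (\<lambda>x y. tens V (tensor V V) x (tens V V y z)) t)"
    by (intro bilinear_mapI linear_lift_param tensor_universal(1) b1 V is_vspace_tensor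
        linear_tens_right linear_map_id)
  show "linear_map (tensor (tensor V V) V) (tensor V (tensor V V)) (tensor_assoc V)"
    unfolding tensor_assoc_def by (intro tensor_universal(1) b2 V is_vspace_tensor)
  show "tensor_assoc V (tens (tensor V V) V (tens V V x y) z) = tens V (tensor V V) x (tens V V y z)"
    if "x \<in> carr V" "y \<in> carr V" "z \<in> carr V"
    unfolding tensor_assoc_def
    by (simp add: tensor_universal(2)[OF is_vspace_tensor V is_vspace_tensor b2] that tens_in_tensor
        tensor_universal(2)[OF V V is_vspace_tensor b1])
qed

lemma tensor_form_assoc:
  assumes V: "is_vspace V" and f: "linear_map V base_field f" and g: "linear_map V base_field g"
    and h: "linear_map V base_field h" and T: "T \<in> carr (tensor (tensor V V) V)"
  shows "tensor_form V (tensor V V) f (tensor_form V V g h) (tensor_assoc V T)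
    = tensor_form (tensor V V) V (tensor_form V V f g) h T"
proof (rule linear_ext_tens[OF is_vspace_tensor V is_vspace_base_field _ _ _ T])
  let ?L = "\<lambda>T. tensor_form V (tensor V V) f (tensor_form V V g h) (tensor_assoc V T)"
  let ?R = "tensor_form (tensor V V) V (tensor_form V V f g) h"
  show L: "linear_map (tensor (tensor V V) V) base_field ?L"
    by (intro linear_map_compose[OF linear_tensor_assoc(1)] linear_tensor_form V is_vspace_tensor f g h)
  show R: "linear_map (tensor (tensor V V) V) base_field ?R"
    by (intro linear_tensor_form V is_vspace_tensor f g h)
  fix t z assume t: "t \<in> carr (tensor V V)" and z: "z \<in> carr V"
  show "?L (tens (tensor V V) V t z) = ?R (tens (tensor V V) V t z)"
  proof (rule linear_ext_tens[OF V V is_vspace_base_field _ _ _ t])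
    show "linear_map (tensor V V) base_field (\<lambda>t. ?L (tens (tensor V V) V t z))"
      by (intro linear_map_compose[OF _ L] linear_tens_left linear_map_id V is_vspace_tensor z)
    show "linear_map (tensor V V) base_field (\<lambda>t. ?R (tens (tensor V V) V t z))"
      by (intro linear_map_compose[OF _ R] linear_tens_left linear_map_id V is_vspace_tensor z)
    show "?L (tens (tensor V V) V (tens V V x y) z) = ?R (tens (tensor V V) V (tens V V x y) z)"
      if "x \<in> carr V" "y \<in> carr V" for x y
      by (simp add: that z linear_tensor_assoc(2)[OF V] tensor_form_tens linear_tensor_form V f g h
          is_vspace_tensor tens_in_tensor)
  qed
qed


section \<open>Frames\<close>

text \<open>A resolution of the identity. The one equation \<open>x = \<Sum> f\<^sub>i(x) e\<^sub>i\<close> is kept instead of a basis with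
its dual basis, because it passes to tensor products by expanding both factors, and to duals by
transposition.\<close>

definition frame ::
  "('k::field_char_0, 'v::ab_group_add) vspace \<Rightarrow> 'i set \<Rightarrow> ('i \<Rightarrow> 'v) \<Rightarrow> ('i \<Rightarrow> 'v \<Rightarrow> 'k) \<Rightarrow> bool"
where
  "frame V I e f \<longleftrightarrow> finite I \<and> (\<forall>i\<in>I. e i \<in> carr V \<and> linear_map V base_field (f i)) \<and>
     (\<forall>x\<in>carr V. x = (\<Sum>i\<in>I. smul V (f i x) (e i)))"

lemma frame_eqI:
  assumes "frame V I e f" "x \<in> carr V" "y \<in> carr V" "\<And>i. i \<in> I \<Longrightarrow> f i x = f i y"
  shows "x = y"
proof -
  have "x = (\<Sum>i\<in>I. smul V (f i x) (e i))"
    using assms(1,2) by (simp add: frame_def)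
  also have "\<dots> = (\<Sum>i\<in>I. smul V (f i y) (e i))"
    using assms(4) by simp
  also have "\<dots> = y"
    using assms(1,3) by (simp add: frame_def)
  finally show ?thesis .
qed

lemma finite_dim_frame:
  fixes V :: "('k::field_char_0, 'v::ab_group_add) vspace"
  assumes V: "is_vspace V" and fin: "finite_dim V"
  obtains I e f where "frame V (I :: 'v set) e f"
proof -
  interpret vector_space "smul V" using V by (simp add: is_vspace_def)
  obtain S where S: "finite S" "span S = carr V" using fin by (auto simp: finite_dim_def)
  obtain B where B: "B \<subseteq> S" "independent B" "S \<subseteq> span B"
    using maximal_independent_subset[of S] by blast
  have sp: "span B = carr V" using B S(2) by (metis span_eq span_superset subset_trans)
  have finB: "finite B" using B(1) S(1) finite_subset by blast
  have "frame V B (\<lambda>b. b) (\<lambda>b x. representation B x b)"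
    unfolding frame_def
  proof (intro conjI ballI finB)
    show "b \<in> carr V" if "b \<in> B" for b using that sp span_base by blast
    show "linear_map V base_field (\<lambda>x. representation B x b)" for b
      by (rule linear_mapI) (simp_all add: sp[symmetric] representation_add[OF B(2)] representation_scale[OF B(2)])
    show "x = (\<Sum>b\<in>B. smul V (representation B x b) b)" if "x \<in> carr V" for x
      using sum_representation_eq[OF B(2) _ finB order_refl, of x] that sp by simp
  qed
  then show ?thesis by (rule that)
qed

lemma frame_tensor:
  assumes V: "is_vspace V" and W: "is_vspace W" and F: "frame V I e f" and G: "frame W J d g"
  shows "frame (tensor V W) (I \<times> J) (\<lambda>(i, j). tens V W (e i) (d j))
    (\<lambda>(i, j). tensor_form V W (f i) (g j))"
  unfolding frame_def
proof (intro conjI ballI)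
  note F' = F[unfolded frame_def] and G' = G[unfolded frame_def]
  note T = is_vspace_tensor[of V W]
  show "finite (I \<times> J)" using F' G' by simp
  show e: "(case p of (i, j) \<Rightarrow> tens V W (e i) (d j)) \<in> carr (tensor V W)" if "p \<in> I \<times> J" for p
    using that F' G' by (auto intro: tens_in_tensor)
  show f: "linear_map (tensor V W) base_field (case p of (i, j) \<Rightarrow> tensor_form V W (f i) (g j))"
    if "p \<in> I \<times> J" for p
    using that F' G' by (auto intro: linear_tensor_form V W)
  let ?s = "\<lambda>t. \<Sum>p\<in>I\<times>J. smul (tensor V W) ((case p of (i, j) \<Rightarrow> tensor_form V W (f i) (g j)) t)
      (case p of (i, j) \<Rightarrow> tens V W (e i) (d j))"
  fix t assume t: "t \<in> carr (tensor V W)"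
  show "t = ?s t"
  proof (rule linear_ext_tens[OF V W T linear_map_id _ _ t])
    show "linear_map (tensor V W) (tensor V W) ?s"
      by (intro linear_sum linear_smul_vector T e f)
    fix x y assume x: "x \<in> carr V" and y: "y \<in> carr W"
    have ex: "smul V (f i x) (e i) \<in> carr V" if "i \<in> I" for i
      using that F' by (simp add: is_vspaceD[OF V])
    have dy: "smul W (g j y) (d j) \<in> carr W" if "j \<in> J" for j
      using that G' by (simp add: is_vspaceD[OF W])
    have "tens V W x y = tens V W (\<Sum>i\<in>I. smul V (f i x) (e i)) (\<Sum>j\<in>J. smul W (g j y) (d j))"
      using F' G' x y by simp
    also have "\<dots> = (\<Sum>i\<in>I. tens V W (smul V (f i x) (e i)) (\<Sum>j\<in>J. smul W (g j y) (d j)))"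
      by (intro linear_map_sum_arg[OF V linear_tens_left[OF V W linear_map_id]] sum_in_carr W dy ex)
    also have "\<dots> = (\<Sum>i\<in>I. \<Sum>j\<in>J. tens V W (smul V (f i x) (e i)) (smul W (g j y) (d j)))"
      by (intro sum.cong refl linear_map_sum_arg[OF W linear_tens_right[OF V W linear_map_id]] dy ex)
    also have "\<dots> = (\<Sum>i\<in>I. \<Sum>j\<in>J. smul (tensor V W) (f i x * g j y) (tens V W (e i) (d j)))"
    proof (intro sum.cong refl)
      fix i j assume ij: "i \<in> I" "j \<in> J"
      have "tens V W (smul V (f i x) (e i)) (smul W (g j y) (d j))
          = smul (tensor V W) (g j y) (tens V W (smul V (f i x) (e i)) (d j))"
        using linear_mapD(3)[OF linear_tens_right[OF V W linear_map_id ex[OF ij(1)]], of "d j"] ij G' by simp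
      also have "\<dots> = smul (tensor V W) (f i x * g j y) (tens V W (e i) (d j))"
        using F' G' ij by (simp add: smul_tens[symmetric] is_vspace_scale[OF T] mult.commute)
      finally show "tens V W (smul V (f i x) (e i)) (smul W (g j y) (d j))
          = smul (tensor V W) (f i x * g j y) (tens V W (e i) (d j))" .
    qed
    also have "\<dots> = ?s (tens V W x y)"
      unfolding sum.cartesian_product using F' G' x y
      by (intro sum.cong refl) (auto simp: tensor_form_tens V W)
    finally show "tens V W x y = ?s (tens V W x y)" .
  qed
qed


section \<open>The dual space\<close>

lemma carr_dual: "\<phi> \<in> carr (dual V) \<longleftrightarrow> linear_map V base_field \<phi> \<and> (\<forall>x. x \<notin> carr V \<longrightarrow> \<phi> x = 0)"
  by (simp add: dual_def)

lemma dual_linear: "\<phi> \<in> carr (dual V) \<Longrightarrow> linear_map V base_field \<phi>"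
  by (simp add: carr_dual)

lemma smul_dual [simp]: "smul (dual V) c \<phi> = (\<lambda>x. c * \<phi> x)"
  by (simp add: dual_def pointwise_def)

lemma is_vspace_dual:
  fixes V :: "('k::field_char_0, 'v::ab_group_add) vspace"
  shows "is_vspace (dual V)"
proof -
  interpret vector_space "pointwise :: 'k \<Rightarrow> ('v \<Rightarrow> 'k) \<Rightarrow> 'v \<Rightarrow> 'k" by (rule vector_space_pointwise)
  have "subspace (carr (dual V))"
    unfolding subspace_def by (auto simp: carr_dual linear_map_def pointwise_def algebra_simps)
  then show ?thesis by (simp add: is_vspace_def vector_space_pointwise dual_def)
qed

lemma dual_eqI:
  assumes "\<phi> \<in> carr (dual V)" "\<psi> \<in> carr (dual V)" "\<And>x. x \<in> carr V \<Longrightarrow> \<phi> x = \<psi> x"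
  shows "\<phi> = \<psi>"
  using assms by (auto simp: carr_dual fun_eq_iff) metis

lemma restr_in_dual:
  assumes "is_vspace V" "linear_map V base_field f"
  shows "restr V f \<in> carr (dual V)"
  unfolding carr_dual
  using linear_map_cong[OF assms(1) _ assms(2), of "restr V f"] by (simp add: restr_def)

lemma linear_eval: "linear_map (dual V) base_field (\<lambda>\<phi>. \<phi> x)"
  by (rule linear_mapI) simp_all

lemma linear_into_dualI:
  assumes "\<And>z. z \<in> carr Z \<Longrightarrow> F z \<in> carr (dual V)"
    and "\<And>x. x \<in> carr V \<Longrightarrow> linear_map Z base_field (\<lambda>z. F z x)"
    and "is_vspace Z"
  shows "linear_map Z (dual V) F"
proof (rule linear_mapI)
  note D = is_vspaceD[OF is_vspace_dual]
  show F: "F z \<in> carr (dual V)" if "z \<in> carr Z" for z by (rule assms(1)[OF that])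
  show "F (y + z) = F y + F z" if "y \<in> carr Z" "z \<in> carr Z" for y z
    by (rule dual_eqI[of _ V])
      (use that linear_mapD(2)[OF assms(2)] in \<open>auto intro!: F D(2) is_vspaceD(2)[OF assms(3)]\<close>)
  show "F (smul Z c z) = smul (dual V) c (F z)" if "z \<in> carr Z" for c z
  proof (rule dual_eqI[of _ V])
    show "smul (dual V) c (F z) \<in> carr (dual V)" by (intro D(3) F that)
  qed (use that linear_mapD(3)[OF assms(2)] in \<open>auto intro!: F is_vspaceD(3)[OF assms(3)]\<close>)
qed

lemma frame_linear_expand:
  assumes V: "is_vspace V" and F: "frame V I e f" and h: "linear_map V base_field h" and x: "x \<in> carr V"
  shows "h x = (\<Sum>i\<in>I. f i x * h (e i))"
proof -
  have "h x = h (\<Sum>i\<in>I. smul V (f i x) (e i))" using F x by (simp add: frame_def)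
  also have "\<dots> = (\<Sum>i\<in>I. h (smul V (f i x) (e i)))"
    using F by (intro linear_map_sum_arg[OF V h]) (auto simp: frame_def is_vspaceD[OF V])
  also have "\<dots> = (\<Sum>i\<in>I. f i x * h (e i))"
    using F by (intro sum.cong refl) (auto simp: frame_def linear_mapD(3)[OF h])
  finally show ?thesis .
qed

text \<open>The elements of \<open>dual V\<close> vanish outside \<open>carr V\<close>, hence the functionals of a frame are
replaced by their restrictions here.\<close>

lemma finite_dim_dual_frame:
  fixes V :: "('k::field_char_0, 'v::ab_group_add) vspace"
  assumes V: "is_vspace V" and fin: "finite_dim V"
  shows "\<exists>(I :: 'v set) e f. frame V I e f \<and> (\<forall>i\<in>I. f i \<in> carr (dual V))"
proof -
  obtain I e f where F: "frame V (I :: 'v set) e f" using finite_dim_frame[OF V fin] .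
  have f': "restr V (f i) \<in> carr (dual V)" if "i \<in> I" for i
    using that F by (intro restr_in_dual V) (simp add: frame_def)
  have "frame V I e (\<lambda>i. restr V (f i))"
    unfolding frame_def
  proof (intro conjI ballI)
    show "x = (\<Sum>i\<in>I. smul V (restr V (f i) x) (e i))" if "x \<in> carr V" for x
      using F that by (simp add: frame_def restr_def)
  qed (use F f' dual_linear in \<open>auto simp: frame_def\<close>)
  then show ?thesis using f' by blast
qed

text \<open>Transposing \<open>x = \<Sum> f\<^sub>i(x) e\<^sub>i\<close> gives \<open>\<phi> = \<Sum> \<phi>(e\<^sub>i) f\<^sub>i\<close>: the vectors and the functionals
exchange their roles, and the functionals of the new frame are evaluations. Hence elements of
\<open>V\<^sup>* \<otimes> V\<^sup>*\<close> are separated by evaluation at pairs of vectors.\<close>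

lemma frame_dual:
  assumes V: "is_vspace V" and F: "frame V I e f" and f: "\<And>i. i \<in> I \<Longrightarrow> f i \<in> carr (dual V)"
  shows "frame (dual V) I f (\<lambda>i \<phi>. \<phi> (e i))"
  unfolding frame_def
proof (intro conjI ballI f linear_eval)
  show "finite I" using F by (simp add: frame_def)
  fix \<phi> assume \<phi>: "\<phi> \<in> carr (dual V)"
  show "\<phi> = (\<Sum>i\<in>I. smul (dual V) (\<phi> (e i)) (f i))"
  proof (rule dual_eqI[OF \<phi>])
    show "(\<Sum>i\<in>I. smul (dual V) (\<phi> (e i)) (f i)) \<in> carr (dual V)"
      by (intro sum_in_carr is_vspace_dual is_vspaceD(3) f)
    show "\<phi> x = (\<Sum>i\<in>I. smul (dual V) (\<phi> (e i)) (f i)) x" if "x \<in> carr V" for x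
      using frame_linear_expand[OF V F dual_linear[OF \<phi>] that] by (simp add: sum_fun_apply mult.commute)
  qed
qed


section \<open>Nondegeneracy of the pairings\<close>

context
  fixes V :: "('k::field_char_0, 'v::ab_group_add) vspace"
  assumes V: "is_vspace V" and fin: "finite_dim V"
begin

lemma tensor_eqI:
  assumes "S \<in> carr (tensor V V)" "T \<in> carr (tensor V V)"
    and "\<And>\<phi> \<psi>. \<phi> \<in> carr (dual V) \<Longrightarrow> \<psi> \<in> carr (dual V) \<Longrightarrow>
      tensor_form V V \<phi> \<psi> S = tensor_form V V \<phi> \<psi> T"
  shows "S = T"
proof -
  obtain I e f where F: "frame V (I :: 'v set) e f" and f: "\<And>i. i \<in> I \<Longrightarrow> f i \<in> carr (dual V)"
    using finite_dim_dual_frame[OF V fin] by blast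
  show ?thesis
    by (rule frame_eqI[OF frame_tensor[OF V V F F] assms(1,2)]) (auto intro: assms(3) f)
qed

lemma tensor_left_eqI:
  assumes "S \<in> carr (tensor (tensor V V) V)" "T \<in> carr (tensor (tensor V V) V)"
    and "\<And>\<phi> \<psi> \<chi>. \<phi> \<in> carr (dual V) \<Longrightarrow> \<psi> \<in> carr (dual V) \<Longrightarrow> \<chi> \<in> carr (dual V) \<Longrightarrow>
      tensor_form (tensor V V) V (tensor_form V V \<phi> \<psi>) \<chi> S
      = tensor_form (tensor V V) V (tensor_form V V \<phi> \<psi>) \<chi> T"
  shows "S = T"
proof -
  obtain I e f where F: "frame V (I :: 'v set) e f" and f: "\<And>i. i \<in> I \<Longrightarrow> f i \<in> carr (dual V)"
    using finite_dim_dual_frame[OF V fin] by blast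
  show ?thesis
    by (rule frame_eqI[OF frame_tensor[OF is_vspace_tensor V frame_tensor[OF V V F F] F] assms(1,2)])
      (auto intro: assms(3) f)
qed

lemma tensor_right_eqI:
  assumes "S \<in> carr (tensor V (tensor V V))" "T \<in> carr (tensor V (tensor V V))"
    and "\<And>\<phi> \<psi> \<chi>. \<phi> \<in> carr (dual V) \<Longrightarrow> \<psi> \<in> carr (dual V) \<Longrightarrow> \<chi> \<in> carr (dual V) \<Longrightarrow>
      tensor_form V (tensor V V) \<phi> (tensor_form V V \<psi> \<chi>) S
      = tensor_form V (tensor V V) \<phi> (tensor_form V V \<psi> \<chi>) T"
  shows "S = T"
proof -
  obtain I e f where F: "frame V (I :: 'v set) e f" and f: "\<And>i. i \<in> I \<Longrightarrow> f i \<in> carr (dual V)"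
    using finite_dim_dual_frame[OF V fin] by blast
  show ?thesis
    by (rule frame_eqI[OF frame_tensor[OF V is_vspace_tensor F frame_tensor[OF V V F F]] assms(1,2)])
      (auto intro: assms(3) f)
qed

lemma tensor_dual_eqI:
  assumes "S \<in> carr (tensor (dual V) (dual V))" "T \<in> carr (tensor (dual V) (dual V))"
    and "\<And>x y. x \<in> carr V \<Longrightarrow> y \<in> carr V \<Longrightarrow>
      tensor_form (dual V) (dual V) (\<lambda>\<xi>. \<xi> x) (\<lambda>\<eta>. \<eta> y) S
      = tensor_form (dual V) (dual V) (\<lambda>\<xi>. \<xi> x) (\<lambda>\<eta>. \<eta> y) T"
  shows "S = T"
proof -
  obtain I e f where F: "frame V (I :: 'v set) e f" and f: "\<And>i. i \<in> I \<Longrightarrow> f i \<in> carr (dual V)"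
    using finite_dim_dual_frame[OF V fin] by blast
  have e: "e i \<in> carr V" if "i \<in> I" for i using F that by (simp add: frame_def)
  note G = frame_dual[OF V F f]
  show ?thesis
    by (rule frame_eqI[OF frame_tensor[OF is_vspace_dual is_vspace_dual G G] assms(1,2)])
      (auto intro: assms(3) e)
qed

lemma tensor_dual_right_eqI:
  fixes S T :: "(('v \<Rightarrow> 'k) \<Rightarrow> ((('v \<Rightarrow> 'k) \<Rightarrow> ('v \<Rightarrow> 'k) \<Rightarrow> 'k) \<Rightarrow> 'k) \<Rightarrow> 'k) \<Rightarrow> 'k"
  defines "D \<equiv> dual V"
  assumes "S \<in> carr (tensor D (tensor D D))" "T \<in> carr (tensor D (tensor D D))"
    and "\<And>x y z. x \<in> carr V \<Longrightarrow> y \<in> carr V \<Longrightarrow> z \<in> carr V \<Longrightarrow>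
      tensor_form D (tensor D D) (\<lambda>\<xi>. \<xi> x) (tensor_form D D (\<lambda>\<eta>. \<eta> y) (\<lambda>\<zeta>. \<zeta> z)) S
      = tensor_form D (tensor D D) (\<lambda>\<xi>. \<xi> x) (tensor_form D D (\<lambda>\<eta>. \<eta> y) (\<lambda>\<zeta>. \<zeta> z)) T"
  shows "S = T"
proof -
  obtain I e f where F: "frame V (I :: 'v set) e f" and f: "\<And>i. i \<in> I \<Longrightarrow> f i \<in> carr (dual V)"
    using finite_dim_dual_frame[OF V fin] by blast
  have e: "e i \<in> carr V" if "i \<in> I" for i using F that by (simp add: frame_def)
  note G = frame_dual[OF V F f, folded D_def] and D = is_vspace_dual[of V, folded D_def]
  show ?thesis
    by (rule frame_eqI[OF frame_tensor[OF D is_vspace_tensor G frame_tensor[OF D D G G]] assms(2,3)])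
      (auto intro: assms(4) e)
qed

text \<open>The definite description that defines \<open>\<mu>\<^sup>*(\<phi>)\<close> denotes: for a frame \<open>e\<^sub>i, f\<^sub>i\<close> the tensor
\<open>\<Sum> \<phi>(\<mu>(e\<^sub>i, e\<^sub>j)) f\<^sub>i \<otimes> f\<^sub>j\<close> has the required values, as follows by expanding both
arguments of \<open>\<mu>\<close>, and evaluations at pairs of vectors leave no other choice.\<close>

lemma dual_comult:
  assumes \<mu>: "bilinear_map V V V \<mu>" and \<phi>: "\<phi> \<in> carr (dual V)"
  shows "dual_comult V \<mu> \<phi> \<in> carr (tensor (dual V) (dual V))"
    and "\<lbrakk>x \<in> carr V; y \<in> carr V\<rbrakk> \<Longrightarrow>
      tensor_form (dual V) (dual V) (\<lambda>\<xi>. \<xi> x) (\<lambda>\<eta>. \<eta> y) (dual_comult V \<mu> \<phi>) = \<phi> (\<mu> x y)"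
proof -
  let ?D = "dual V"
  let ?DD = "tensor ?D ?D"
  let ?P = "\<lambda>T. T \<in> carr ?DD \<and> (\<forall>x\<in>carr V. \<forall>y\<in>carr V.
      tensor_form ?D ?D (\<lambda>\<xi>. \<xi> x) (\<lambda>\<eta>. \<eta> y) T = \<phi> (\<mu> x y))"
  note D = is_vspace_dual[of V]
  obtain I e f where F: "frame V (I :: 'v set) e f" and f: "\<And>i. i \<in> I \<Longrightarrow> f i \<in> carr (dual V)"
    using finite_dim_dual_frame[OF V fin] by blast
  have e: "e i \<in> carr V" if "i \<in> I" for i using F that by (simp add: frame_def)
  let ?t = "\<lambda>i j. smul ?DD (\<phi> (\<mu> (e i) (e j))) (tens ?D ?D (f i) (f j))"
  let ?T = "\<Sum>i\<in>I. \<Sum>j\<in>I. ?t i j"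
  have t: "?t i j \<in> carr ?DD" if "i \<in> I" "j \<in> I" for i j
    by (intro is_vspaceD(3)[OF is_vspace_tensor] tens_in_tensor f that)
  have "tensor_form ?D ?D (\<lambda>\<xi>. \<xi> x) (\<lambda>\<eta>. \<eta> y) ?T = \<phi> (\<mu> x y)"
    if x: "x \<in> carr V" and y: "y \<in> carr V" for x y
  proof -
    note lin = linear_tensor_form[OF D D linear_eval[of V x] linear_eval[of V y]]
    have "tensor_form ?D ?D (\<lambda>\<xi>. \<xi> x) (\<lambda>\<eta>. \<eta> y) ?T
      = (\<Sum>i\<in>I. \<Sum>j\<in>I. tensor_form ?D ?D (\<lambda>\<xi>. \<xi> x) (\<lambda>\<eta>. \<eta> y) (?t i j))"
      by (rule linear_map_double_sum_arg[OF is_vspace_tensor lin t])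
    also have "\<dots> = (\<Sum>i\<in>I. \<Sum>j\<in>I. \<phi> (\<mu> (e i) (e j)) * (f i x * f j y))"
      by (intro sum.cong refl)
        (simp add: linear_mapD(3)[OF lin] tens_in_tensor f tensor_form_tens[OF D D linear_eval linear_eval])
    also have "\<dots> = (\<Sum>i\<in>I. f i x * (\<Sum>j\<in>I. f j y * \<phi> (\<mu> (e i) (e j))))"
      by (simp add: sum_distrib_left mult_ac)
    also have "\<dots> = (\<Sum>i\<in>I. f i x * \<phi> (\<mu> (e i) y))"
    proof (intro sum.cong refl)
      fix i assume i: "i \<in> I"
      have "\<phi> (\<mu> (e i) y) = (\<Sum>j\<in>I. f j y * \<phi> (\<mu> (e i) (e j)))"
        by (intro frame_linear_expand[OF V F _ y]
            linear_map_compose[OF bilinear_mapD(1)[OF \<mu> e[OF i]] dual_linear[OF \<phi>]])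
      then show "f i x * (\<Sum>j\<in>I. f j y * \<phi> (\<mu> (e i) (e j))) = f i x * \<phi> (\<mu> (e i) y)" by simp
    qed
    also have "\<dots> = \<phi> (\<mu> x y)"
      by (intro frame_linear_expand[OF V F _ x, symmetric]
            linear_map_compose[OF bilinear_mapD(2)[OF \<mu> y] dual_linear[OF \<phi>]])
    finally show ?thesis .
  qed
  moreover have "?T \<in> carr ?DD"
    by (intro sum_in_carr is_vspace_tensor t)
  ultimately have "?P ?T" by blast
  then have ex1: "\<exists>!T. ?P T"
  proof (rule ex1I[of ?P ?T])
    show "S = ?T" if "?P S" for S
      by (rule tensor_dual_eqI) (simp_all add: that \<open>?P ?T\<close>)
  qed
  have eq: "dual_comult V \<mu> \<phi> = (THE T. ?P T)"
    by (simp add: dual_comult_def tensor_form_def)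
  have P: "?P (dual_comult V \<mu> \<phi>)"
    unfolding eq by (rule theI'[OF ex1])
  show "dual_comult V \<mu> \<phi> \<in> carr ?DD" using P by (rule conjunct1)
  show "tensor_form ?D ?D (\<lambda>\<xi>. \<xi> x) (\<lambda>\<eta>. \<eta> y) (dual_comult V \<mu> \<phi>) = \<phi> (\<mu> x y)"
    if "x \<in> carr V" "y \<in> carr V" using P that by simp
qed

text \<open>Sweedler notation for \<open>\<mu>\<^sup>*(\<phi>)\<close>, with the rule \<open>\<Sum> \<phi>\<^sub>1(x) \<phi>\<^sub>2(y) = \<phi>(\<mu>(x, y))\<close>.\<close>

lemma dual_comult_decomp:
  assumes "bilinear_map V V V \<mu>" "\<phi> \<in> carr (dual V)"
  shows "\<exists>(n :: nat) p q. (\<forall>i. p i \<in> carr (dual V)) \<and> (\<forall>i. q i \<in> carr (dual V)) \<and>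
    dual_comult V \<mu> \<phi> = (\<Sum>i<n. tens (dual V) (dual V) (p i) (q i)) \<and>
    (\<forall>x\<in>carr V. \<forall>y\<in>carr V. (\<Sum>i<n. p i x * q i y) = \<phi> (\<mu> x y))"
proof -
  note D = is_vspace_dual[of V]
  obtain n p q where pq: "\<And>i. p i \<in> carr (dual V)" "\<And>i. q i \<in> carr (dual V)"
    and eq: "dual_comult V \<mu> \<phi> = (\<Sum>i<(n::nat). tens (dual V) (dual V) (p i) (q i))"
    using tensor_decomp_sum[OF D D dual_comult(1)[OF assms]] by blast
  show ?thesis
  proof (intro exI conjI allI ballI)
    show "p i \<in> carr (dual V)" "q i \<in> carr (dual V)" for i by (fact pq)+
    show "dual_comult V \<mu> \<phi> = (\<Sum>i<n. tens (dual V) (dual V) (p i) (q i))" by (fact eq)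
    show "(\<Sum>i<n. p i x * q i y) = \<phi> (\<mu> x y)" if "x \<in> carr V" "y \<in> carr V" for x y
    proof -
      have "\<phi> (\<mu> x y) = tensor_form (dual V) (dual V) (\<lambda>\<xi>. \<xi> x) (\<lambda>\<eta>. \<eta> y)
          (\<Sum>i<n. tens (dual V) (dual V) (p i) (q i))"
        using dual_comult(2)[OF assms that] eq by simp
      also have "\<dots> = (\<Sum>i<n. p i x * q i y)"
        by (rule tensor_form_tens_sum[OF D D linear_eval linear_eval pq])
      finally show ?thesis by (rule sym)
    qed
  qed
qed

end


section \<open>The factorwise product and the flip\<close>

lemma tensor_mult_tens_sum:
  assumes V: "is_vspace V" and \<mu>: "bilinear_map V V V \<mu>"
    and ab: "\<And>i. a i \<in> carr V" "\<And>i. b i \<in> carr V" and cd: "\<And>j. c j \<in> carr V" "\<And>j. d j \<in> carr V"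
  shows "tensor_mult V \<mu> (\<Sum>i<m. tens V V (a i) (b i)) (\<Sum>j<n. tens V V (c j) (d j))
    = (\<Sum>i<(m::nat). \<Sum>j<(n::nat). tens V V (\<mu> (a i) (c j)) (\<mu> (b i) (d j)))"
  unfolding tensor_mult_def
  by (rule tensor_lift_lift_tens_sum[OF V V V V is_vspace_tensor[of V V] _ _ _ _ ab cd])
    (intro linear_tens_left linear_tens_right V bilinear_mapD[OF \<mu>]; assumption)+

lemma tensor_mult_in_carr:
  assumes V: "is_vspace V" and \<mu>: "bilinear_map V V V \<mu>"
    and S: "S \<in> carr (tensor V V)" and T: "T \<in> carr (tensor V V)"
  shows "tensor_mult V \<mu> S T \<in> carr (tensor V V)"
proof -
  obtain m a b where ab: "\<And>i. a i \<in> carr V" "\<And>i. b i \<in> carr V"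
    and S': "S = (\<Sum>i<(m::nat). tens V V (a i) (b i))"
    using tensor_decomp_sum[OF V V S] by blast
  obtain n c d where cd: "\<And>j. c j \<in> carr V" "\<And>j. d j \<in> carr V"
    and T': "T = (\<Sum>j<(n::nat). tens V V (c j) (d j))"
    using tensor_decomp_sum[OF V V T] by blast
  show ?thesis
    unfolding S' T' tensor_mult_tens_sum[OF V \<mu> ab cd]
    by (intro sum_in_carr is_vspace_tensor tens_in_tensor bilinear_mapD(3)[OF \<mu>] ab cd)
qed

lemma tensor_form_tensor_mult:
  assumes V: "is_vspace V" and \<mu>: "bilinear_map V V V \<mu>"
    and ab: "\<And>i. a i \<in> carr V" "\<And>i. b i \<in> carr V" and cd: "\<And>j. c j \<in> carr V" "\<And>j. d j \<in> carr V"
    and f: "linear_map V base_field f" and g: "linear_map V base_field g"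
  shows "tensor_form V V f g (tensor_mult V \<mu> (\<Sum>i<m. tens V V (a i) (b i)) (\<Sum>j<n. tens V V (c j) (d j)))
    = (\<Sum>i<(m::nat). \<Sum>j<(n::nat). f (\<mu> (a i) (c j)) * g (\<mu> (b i) (d j)))"
proof -
  have in_V: "\<mu> (a i) (c j) \<in> carr V" "\<mu> (b i) (d j) \<in> carr V" for i j
    by (intro bilinear_mapD(3)[OF \<mu>] ab cd)+
  have "tensor_form V V f g (\<Sum>i<m. \<Sum>j<n. tens V V (\<mu> (a i) (c j)) (\<mu> (b i) (d j)))
    = (\<Sum>i<m. \<Sum>j<n. tensor_form V V f g (tens V V (\<mu> (a i) (c j)) (\<mu> (b i) (d j))))"
    by (rule linear_map_double_sum_arg[OF is_vspace_tensor linear_tensor_form[OF V V f g]])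
      (rule tens_in_tensor[OF in_V])
  then show ?thesis
    unfolding tensor_mult_tens_sum[OF V \<mu> ab cd] by (simp add: tensor_form_tens V f g in_V)
qed

lemma tensor_flip_tens_sum:
  assumes V: "is_vspace V" and ab: "\<And>i. a i \<in> carr V" "\<And>i. b i \<in> carr V"
  shows "tensor_flip V (\<Sum>i<n. tens V V (a i) (b i)) = (\<Sum>i<(n::nat). tens V V (b i) (a i))"
  unfolding tensor_flip_def
proof (rule tensor_lift_tens_sum[OF V V is_vspace_tensor _ ab])
  show "bilinear_map V V (tensor V V) (\<lambda>x y. tens V V y x)"
    using bilinear_map_tens[OF V V] by (simp add: bilinear_map_def)
qed

lemma tensor_flip_in:
  assumes V: "is_vspace V" and "T \<in> carr (tensor V V)"
  shows "tensor_flip V T \<in> carr (tensor V V)"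
proof -
  obtain n a b where ab: "\<And>i. a i \<in> carr V" "\<And>i. b i \<in> carr V"
    and T: "T = (\<Sum>i<(n::nat). tens V V (a i) (b i))"
    using tensor_decomp_sum[OF V V assms(2)] by blast
  show ?thesis
    unfolding T tensor_flip_tens_sum[OF V ab] by (intro sum_in_carr is_vspace_tensor tens_in_tensor ab)
qed


section \<open>The dual Hom-bialgebra\<close>

locale finite_dim_hom_bialgebra =
  fixes A :: "('k::field_char_0, 'v::ab_group_add) vspace"
    and \<mu> :: "'v \<Rightarrow> 'v \<Rightarrow> 'v"
    and \<Delta> :: "'v \<Rightarrow> ('v \<Rightarrow> 'v \<Rightarrow> 'k) \<Rightarrow> 'k"
    and \<alpha> :: "'v \<Rightarrow> 'v"
  assumes bialg: "hom_bialgebra A \<mu> \<Delta> \<alpha>" and fin: "finite_dim A"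
begin

abbreviation "D \<equiv> dual A"
abbreviation "mul \<equiv> dual_mult A \<Delta>"
abbreviation "comul \<equiv> dual_comult A \<mu>"
abbreviation "twist \<equiv> dual_map A \<alpha>"
abbreviation "ev (x :: 'v) \<equiv> (\<lambda>\<xi> :: 'v \<Rightarrow> 'k. \<xi> x)"
abbreviation "\<alpha>\<Delta> \<equiv> tensor_map A A A (tensor A A) \<alpha> \<Delta>"
abbreviation "\<Delta>\<alpha> \<equiv> tensor_map A A (tensor A A) A \<Delta> \<alpha>"

lemma A: "is_vspace A"
  and \<mu>: "bilinear_map A A A \<mu>"
  and \<Delta>: "linear_map A (tensor A A) \<Delta>"
  and \<alpha>: "linear_map A A \<alpha>"
  and \<alpha>_\<mu>: "\<lbrakk>x \<in> carr A; y \<in> carr A\<rbrakk> \<Longrightarrow> \<alpha> (\<mu> x y) = \<mu> (\<alpha> x) (\<alpha> y)"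
  and hom_assoc: "\<lbrakk>x \<in> carr A; y \<in> carr A; z \<in> carr A\<rbrakk> \<Longrightarrow> \<mu> (\<alpha> x) (\<mu> y z) = \<mu> (\<mu> x y) (\<alpha> z)"
  and \<Delta>_\<alpha>: "x \<in> carr A \<Longrightarrow> tensor_map A A A A \<alpha> \<alpha> (\<Delta> x) = \<Delta> (\<alpha> x)"
  and hom_coassoc: "x \<in> carr A \<Longrightarrow> \<alpha>\<Delta> (\<Delta> x) = tensor_assoc A (\<Delta>\<alpha> (\<Delta> x))"
  and \<Delta>_\<mu>: "\<lbrakk>x \<in> carr A; y \<in> carr A\<rbrakk> \<Longrightarrow> \<Delta> (\<mu> x y) = tensor_mult A \<mu> (\<Delta> x) (\<Delta> y)"
  using bialg by (simp_all add: hom_bialgebra_def)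

lemmas AA = is_vspace_tensor[of A A]
lemmas D = is_vspace_dual[of A]
lemmas \<mu>_in = bilinear_mapD(3)[OF \<mu>]
lemmas \<Delta>_in = linear_mapD(1)[OF \<Delta>]
lemmas \<alpha>_in = linear_mapD(1)[OF \<alpha>]
lemmas comul_in = dual_comult(1)[OF A fin \<mu>]
lemmas eval_comul = dual_comult(2)[OF A fin \<mu>]

lemma mul_apply: "x \<in> carr A \<Longrightarrow> mul \<phi> \<psi> x = tensor_form A A \<phi> \<psi> (\<Delta> x)"
  by (simp add: dual_mult_def restr_def tensor_pair_eq)

lemma twist_apply: "x \<in> carr A \<Longrightarrow> twist \<phi> x = \<phi> (\<alpha> x)"
  by (simp add: dual_map_def restr_def)

lemma mul_in: "\<lbrakk>\<phi> \<in> carr D; \<psi> \<in> carr D\<rbrakk> \<Longrightarrow> mul \<phi> \<psi> \<in> carr D"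
  unfolding dual_mult_def tensor_pair_eq
  by (intro restr_in_dual A linear_map_compose[OF \<Delta>] linear_tensor_form dual_linear)

lemma twist_in: "\<phi> \<in> carr D \<Longrightarrow> twist \<phi> \<in> carr D"
  unfolding dual_map_def comp_def by (intro restr_in_dual A linear_map_compose[OF \<alpha>] dual_linear)

lemma bilinear_mul: "bilinear_map D D D mul"
proof (rule bilinear_mapI)
  show "linear_map D D (mul \<phi>)" if "\<phi> \<in> carr D" for \<phi>
  proof (rule linear_into_dualI[OF mul_in[OF that] _ D])
    show "linear_map D base_field (\<lambda>\<psi>. mul \<phi> \<psi> x)" if "x \<in> carr A" for x
      unfolding mul_apply[OF that]
      by (intro linear_tensor_form_second A D linear_eval dual_linear \<open>\<phi> \<in> carr D\<close> \<Delta>_in that)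
  qed
  show "linear_map D D (\<lambda>\<phi>. mul \<phi> \<psi>)" if "\<psi> \<in> carr D" for \<psi>
  proof (rule linear_into_dualI[OF mul_in[OF _ that] _ D])
    show "linear_map D base_field (\<lambda>\<phi>. mul \<phi> \<psi> x)" if "x \<in> carr A" for x
      unfolding mul_apply[OF that]
      by (intro linear_tensor_form_first A D linear_eval dual_linear \<open>\<psi> \<in> carr D\<close> \<Delta>_in that)
  qed
qed

lemma linear_twist: "linear_map D D twist"
  by (rule linear_into_dualI) (auto simp: twist_in twist_apply linear_eval D)

lemma linear_comul: "linear_map D (tensor D D) comul"
proof (rule linear_mapI)
  note DD = is_vspaceD(2,3)[OF is_vspace_tensor]
  note [simp] = linear_mapD(2,3)[OF linear_tensor_form[OF D D linear_eval linear_eval]] eval_comul comul_in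
  show "comul (\<phi> + \<psi>) = comul \<phi> + comul \<psi>" if "\<phi> \<in> carr D" "\<psi> \<in> carr D" for \<phi> \<psi>
    by (rule tensor_dual_eqI[OF A fin]) (simp_all add: that is_vspaceD(2)[OF D] DD)
  show "comul (smul D c \<phi>) = smul (tensor D D) c (comul \<phi>)" if "\<phi> \<in> carr D" for c \<phi>
    by (rule tensor_dual_eqI[OF A fin])
      (simp_all add: that is_vspaceD(3)[OF D, of \<phi> c, simplified] DD)
qed (rule comul_in)

text \<open>The multiplication of the dual is the transpose of \<open>\<Delta>\<close> and its twisting map that of \<open>\<alpha>\<close>.
Applied to \<open>T = \<Delta>(x)\<close>, this identity and the next turn Hom-coassociativity of \<open>\<Delta>\<close> into
Hom-associativity of the dual; applied to \<open>T = R\<close>, they evaluate the left sides of the first two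
axioms of a cobraiding.\<close>

lemma form_\<Delta>\<alpha>:
  assumes "\<phi> \<in> carr D" "\<psi> \<in> carr D" "\<chi> \<in> carr D" "T \<in> carr (tensor A A)"
  shows "tensor_form A A (mul \<phi> \<psi>) (twist \<chi>) T
    = tensor_form (tensor A A) A (tensor_form A A \<phi> \<psi>) \<chi> (\<Delta>\<alpha> T)"
  by (simp add: tensor_form_tensor_map A AA \<Delta> \<alpha> linear_tensor_form dual_linear assms)
    (intro tensor_form_cong mul_apply twist_apply)

lemma form_\<alpha>\<Delta>:
  assumes "\<phi> \<in> carr D" "\<psi> \<in> carr D" "\<chi> \<in> carr D" "T \<in> carr (tensor A A)"
  shows "tensor_form A A (twist \<phi>) (mul \<psi> \<chi>) T
    = tensor_form A (tensor A A) \<phi> (tensor_form A A \<psi> \<chi>) (\<alpha>\<Delta> T)"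
  by (simp add: tensor_form_tensor_map A AA \<Delta> \<alpha> linear_tensor_form dual_linear assms)
    (intro tensor_form_cong mul_apply twist_apply)

lemma form_\<alpha>\<alpha>:
  assumes "\<phi> \<in> carr D" "\<psi> \<in> carr D" "T \<in> carr (tensor A A)"
  shows "tensor_form A A (twist \<phi>) (twist \<psi>) T = tensor_form A A \<phi> \<psi> (tensor_map A A A A \<alpha> \<alpha> T)"
  by (simp add: tensor_form_tensor_map A \<alpha> dual_linear assms) (intro tensor_form_cong twist_apply)

lemma \<alpha>\<Delta>_in: "T \<in> carr (tensor A A) \<Longrightarrow> \<alpha>\<Delta> T \<in> carr (tensor A (tensor A A))"
  and \<Delta>\<alpha>_in: "T \<in> carr (tensor A A) \<Longrightarrow> \<Delta>\<alpha> T \<in> carr (tensor (tensor A A) A)"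
  and \<alpha>\<alpha>_in: "T \<in> carr (tensor A A) \<Longrightarrow> tensor_map A A A A \<alpha> \<alpha> T \<in> carr (tensor A A)"
  by (rule linear_mapD(1)[OF linear_tensor_map[OF A A]], auto simp: A AA \<alpha> \<Delta>)+

lemma twist_mul:
  assumes "\<phi> \<in> carr D" "\<psi> \<in> carr D"
  shows "twist (mul \<phi> \<psi>) = mul (twist \<phi>) (twist \<psi>)"
  by (rule dual_eqI[of _ A])
    (simp_all add: twist_in mul_in assms twist_apply mul_apply \<alpha>_in \<Delta>_in form_\<alpha>\<alpha> \<Delta>_\<alpha>)

lemma mul_hom_assoc:
  assumes "\<phi> \<in> carr D" "\<psi> \<in> carr D" "\<chi> \<in> carr D"
  shows "mul (twist \<phi>) (mul \<psi> \<chi>) = mul (mul \<phi> \<psi>) (twist \<chi>)"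
proof (rule dual_eqI[of _ A])
  show "mul (twist \<phi>) (mul \<psi> \<chi>) x = mul (mul \<phi> \<psi>) (twist \<chi>) x" if x: "x \<in> carr A" for x
    by (simp add: x mul_apply \<Delta>_in assms form_\<alpha>\<Delta> form_\<Delta>\<alpha> hom_coassoc
        tensor_form_assoc A dual_linear \<Delta>\<alpha>_in)
qed (simp_all add: twist_in mul_in assms)

lemma comul_twist:
  assumes "\<phi> \<in> carr D"
  shows "tensor_map D D D D twist twist (comul \<phi>) = comul (twist \<phi>)"
proof (rule tensor_dual_eqI[OF A fin])
  fix x y assume xy: "x \<in> carr A" "y \<in> carr A"
  have "tensor_form D D (ev x) (ev y) (tensor_map D D D D twist twist (comul \<phi>))
    = tensor_form D D (ev (\<alpha> x)) (ev (\<alpha> y)) (comul \<phi>)"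
    by (simp add: tensor_form_tensor_map D linear_twist linear_eval comul_in assms twist_apply xy)
  then show "tensor_form D D (ev x) (ev y) (tensor_map D D D D twist twist (comul \<phi>))
    = tensor_form D D (ev x) (ev y) (comul (twist \<phi>))"
    by (simp add: eval_comul assms twist_in \<alpha>_in xy twist_apply \<mu>_in \<alpha>_\<mu>)
qed (simp_all add: linear_mapD(1)[OF linear_tensor_map] D linear_twist comul_in twist_in assms)

text \<open>Both sides take the same value at \<open>x \<otimes> (y \<otimes> z)\<close>, namely \<open>\<phi>\<close> of the two sides of
Hom-associativity \<open>\<mu>(\<alpha>(x), \<mu>(y, z)) = \<mu>(\<mu>(x, y), \<alpha>(z))\<close>.\<close>

lemma comul_hom_coassoc:
  assumes \<phi>: "\<phi> \<in> carr D"
  shows "tensor_map D D D (tensor D D) twist comul (comul \<phi>)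
    = tensor_assoc D (tensor_map D D (tensor D D) D comul twist (comul \<phi>))"
proof (rule tensor_dual_right_eqI[OF A fin])
  let ?l = "tensor_map D D D (tensor D D) twist comul (comul \<phi>)"
  let ?r = "tensor_map D D (tensor D D) D comul twist (comul \<phi>)"
  note lin = linear_eval[of A] linear_tensor_form[OF D D linear_eval linear_eval]
  have r: "?r \<in> carr (tensor (tensor D D) D)"
    by (simp add: linear_mapD(1)[OF linear_tensor_map] D linear_twist linear_comul comul_in \<phi>
        is_vspace_tensor)
  then show "tensor_assoc D ?r \<in> carr (tensor D (tensor D D))"
    by (rule linear_mapD(1)[OF linear_tensor_assoc(1)[OF D]])
  show "?l \<in> carr (tensor D (tensor D D))"
    by (simp add: linear_mapD(1)[OF linear_tensor_map] D linear_twist linear_comul comul_in \<phi>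
        is_vspace_tensor)
  fix x y z assume xyz: "x \<in> carr A" "y \<in> carr A" "z \<in> carr A"
  have "tensor_form D (tensor D D) (ev x) (tensor_form D D (ev y) (ev z)) ?l
    = tensor_form D D (\<lambda>\<xi>. twist \<xi> x) (\<lambda>\<eta>. tensor_form D D (ev y) (ev z) (comul \<eta>)) (comul \<phi>)"
    by (simp add: tensor_form_tensor_map D is_vspace_tensor linear_twist linear_comul lin comul_in \<phi>)
  also have "\<dots> = tensor_form D D (ev (\<alpha> x)) (ev (\<mu> y z)) (comul \<phi>)"
    by (rule tensor_form_cong) (simp_all add: twist_apply eval_comul xyz)
  also have "\<dots> = tensor_form D D (ev (\<mu> x y)) (ev (\<alpha> z)) (comul \<phi>)"
    by (simp add: eval_comul \<phi> xyz \<alpha>_in \<mu>_in hom_assoc)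
  also have "\<dots> = tensor_form D D (\<lambda>\<xi>. tensor_form D D (ev x) (ev y) (comul \<xi>)) (\<lambda>\<eta>. twist \<eta> z) (comul \<phi>)"
    by (rule tensor_form_cong) (simp_all add: twist_apply eval_comul xyz)
  also have "\<dots> = tensor_form (tensor D D) D (tensor_form D D (ev x) (ev y)) (ev z) ?r"
    by (simp add: tensor_form_tensor_map D is_vspace_tensor linear_twist linear_comul lin comul_in \<phi>)
  also have "\<dots> = tensor_form D (tensor D D) (ev x) (tensor_form D D (ev y) (ev z)) (tensor_assoc D ?r)"
    by (simp add: tensor_form_assoc D linear_eval r)
  finally show "tensor_form D (tensor D D) (ev x) (tensor_form D D (ev y) (ev z)) ?l
    = tensor_form D (tensor D D) (ev x) (tensor_form D D (ev y) (ev z)) (tensor_assoc D ?r)" .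
qed

text \<open>At \<open>x \<otimes> y\<close> the left side is \<open>\<langle>\<phi> \<otimes> \<psi>, \<Delta>(xy)\<rangle> = \<Sum> \<phi>(x\<^sub>1y\<^sub>1) \<psi>(x\<^sub>2y\<^sub>2)\<close>, and the right
side is \<open>\<Sum> (\<phi>\<^sub>1\<psi>\<^sub>1)(x) (\<phi>\<^sub>2\<psi>\<^sub>2)(y)\<close>. Both are the sum of the terms
\<open>\<phi>\<^sub>1(x\<^sub>1) \<psi>\<^sub>1(x\<^sub>2) \<phi>\<^sub>2(y\<^sub>1) \<psi>\<^sub>2(y\<^sub>2)\<close>, taken in a different order.\<close>

lemma comul_mul:
  assumes \<phi>: "\<phi> \<in> carr D" and \<psi>: "\<psi> \<in> carr D"
  shows "comul (mul \<phi> \<psi>) = tensor_mult D mul (comul \<phi>) (comul \<psi>)"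
proof (rule tensor_dual_eqI[OF A fin])
  show "comul (mul \<phi> \<psi>) \<in> carr (tensor D D)"
    by (intro comul_in mul_in \<phi> \<psi>)
  show "tensor_mult D mul (comul \<phi>) (comul \<psi>) \<in> carr (tensor D D)"
    by (intro tensor_mult_in_carr D bilinear_mul comul_in \<phi> \<psi>)
  fix x y assume x: "x \<in> carr A" and y: "y \<in> carr A"
  obtain m p q where pq: "\<And>i. p i \<in> carr D" "\<And>i. q i \<in> carr D"
    and m: "comul \<phi> = (\<Sum>i<(m::nat). tens D D (p i) (q i))"
      "\<And>x y. x \<in> carr A \<Longrightarrow> y \<in> carr A \<Longrightarrow> (\<Sum>i<m. p i x * q i y) = \<phi> (\<mu> x y)"
    using dual_comult_decomp[OF A fin \<mu> \<phi>] by blast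
  obtain n r s where rs: "\<And>j. r j \<in> carr D" "\<And>j. s j \<in> carr D"
    and n: "comul \<psi> = (\<Sum>j<(n::nat). tens D D (r j) (s j))"
      "\<And>x y. x \<in> carr A \<Longrightarrow> y \<in> carr A \<Longrightarrow> (\<Sum>j<n. r j x * s j y) = \<psi> (\<mu> x y)"
    using dual_comult_decomp[OF A fin \<mu> \<psi>] by blast
  obtain k a b where ab: "\<And>i. a i \<in> carr A" "\<And>i. b i \<in> carr A"
    and k: "\<Delta> x = (\<Sum>i<(k::nat). tens A A (a i) (b i))"
    using tensor_decomp_sum[OF A A \<Delta>_in[OF x]] by blast
  obtain l c d where cd: "\<And>i. c i \<in> carr A" "\<And>i. d i \<in> carr A"
    and l: "\<Delta> y = (\<Sum>j<(l::nat). tens A A (c j) (d j))"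
    using tensor_decomp_sum[OF A A \<Delta>_in[OF y]] by blast
  have "tensor_form D D (ev x) (ev y) (comul (mul \<phi> \<psi>)) = tensor_form A A \<phi> \<psi> (\<Delta> (\<mu> x y))"
    by (simp add: eval_comul mul_in \<phi> \<psi> x y mul_apply \<mu>_in)
  also have "\<dots> = (\<Sum>g<k. \<Sum>h<l. \<phi> (\<mu> (a g) (c h)) * \<psi> (\<mu> (b g) (d h)))"
    by (simp add: \<Delta>_\<mu> x y k l tensor_form_tensor_mult A \<mu> ab cd dual_linear \<phi> \<psi>)
  also have "\<dots> = (\<Sum>g<k. \<Sum>h<l. (\<Sum>i<m. p i (a g) * q i (c h)) * (\<Sum>j<n. r j (b g) * s j (d h)))"
    by (simp add: m(2) n(2) ab cd)
  also have "\<dots> = (\<Sum>i<m. \<Sum>j<n. (\<Sum>g<k. p i (a g) * r j (b g)) * (\<Sum>h<l. q i (c h) * s j (d h)))"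
    by (rule sum_swap_middle)
  also have "\<dots> = (\<Sum>i<m. \<Sum>j<n. mul (p i) (r j) x * mul (q i) (s j) y)"
    by (simp add: mul_apply x y k l tensor_form_tens_sum A dual_linear pq rs ab cd)
  also have "\<dots> = tensor_form D D (ev x) (ev y) (tensor_mult D mul (comul \<phi>) (comul \<psi>))"
    unfolding m(1) n(1) by (simp add: tensor_form_tensor_mult D bilinear_mul pq rs linear_eval)
  finally show "tensor_form D D (ev x) (ev y) (comul (mul \<phi> \<psi>))
    = tensor_form D D (ev x) (ev y) (tensor_mult D mul (comul \<phi>) (comul \<psi>))" .
qed

theorem hom_bialgebra_dual: "hom_bialgebra D mul comul twist"
  unfolding hom_bialgebra_def
  by (simp add: D bilinear_mul linear_comul linear_twist twist_mul mul_hom_assoc comul_twist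
      comul_hom_coassoc comul_mul)


section \<open>The cobraiding conditions, transposed\<close>

lemma bilinear_form_of:
  assumes "R \<in> carr (tensor A A)"
  shows "bilinear_map D D base_field (\<lambda>\<phi> \<psi>. tensor_pair A \<phi> \<psi> R)"
  unfolding tensor_pair_eq
  by (intro bilinear_mapI linear_tensor_form_first linear_tensor_form_second A D linear_eval
      dual_linear assms)

lemma linear_form_of: "R \<in> carr (tensor A A) \<Longrightarrow> linear_map (tensor D D) base_field (form_of A R)"
  unfolding form_of_def by (intro tensor_universal(1) D is_vspace_base_field bilinear_form_of)

lemma form_of_tens:
  assumes "R \<in> carr (tensor A A)" "\<phi> \<in> carr D" "\<psi> \<in> carr D"
  shows "form_of A R (tens D D \<phi> \<psi>) = tensor_form A A \<phi> \<psi> R"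
  unfolding form_of_def
  using tensor_universal(2)[OF D D is_vspace_base_field bilinear_form_of[OF assms(1)] assms(2,3)]
  by (simp add: tensor_pair_eq)

lemma linear_form_of_tens:
  assumes "R \<in> carr (tensor A A)" "\<phi> \<in> carr D"
  shows "linear_map D base_field (\<lambda>\<xi>. form_of A R (tens D D \<phi> \<xi>))"
    and "linear_map D base_field (\<lambda>\<xi>. form_of A R (tens D D \<xi> \<phi>))"
  by (intro linear_map_compose[OF _ linear_form_of[OF assms(1)]] linear_tens_right linear_tens_left
      D linear_map_id assms(2))+

lemma R13_R23_sum:
  assumes s: "\<And>i. s i \<in> carr A" and t: "\<And>i. t i \<in> carr A"
    and R: "R = (\<Sum>i<(n::nat). tens A A (s i) (t i))"
  shows "R13_R23 A \<mu> \<alpha> R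
    = (\<Sum>i<n. \<Sum>j<n. tens (tensor A A) A (tens A A (\<alpha> (s i)) (\<alpha> (s j))) (\<mu> (t i) (t j)))"
  unfolding R R13_R23_def
  by (rule tensor_lift_lift_tens_sum[OF A A A A is_vspace_tensor[of "tensor A A" A] _ _ _ _ s t s t])
    (intro linear_tens_left linear_tens_right A AA linear_map_id \<alpha> bilinear_mapD[OF \<mu>] \<alpha>_in
      tens_in_tensor; assumption)+

lemma R13_R12_sum:
  assumes s: "\<And>i. s i \<in> carr A" and t: "\<And>i. t i \<in> carr A"
    and R: "R = (\<Sum>i<(n::nat). tens A A (s i) (t i))"
  shows "R13_R12 A \<mu> \<alpha> R
    = (\<Sum>i<n. \<Sum>j<n. tens A (tensor A A) (\<mu> (s i) (s j)) (tens A A (\<alpha> (t j)) (\<alpha> (t i))))"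
  unfolding R R13_R12_def
  by (rule tensor_lift_lift_tens_sum[OF A A A A is_vspace_tensor[of A "tensor A A"] _ _ _ _ s t s t])
    (intro linear_tens_left linear_tens_right A AA linear_map_id \<alpha> bilinear_mapD[OF \<mu>] \<alpha>_in
      tens_in_tensor; assumption)+

lemma R13_R23_in:
  assumes "R \<in> carr (tensor A A)"
  shows "R13_R23 A \<mu> \<alpha> R \<in> carr (tensor (tensor A A) A)"
proof -
  obtain n s t where st: "\<And>i. s i \<in> carr A" "\<And>i. t i \<in> carr A"
    and R: "R = (\<Sum>i<(n::nat). tens A A (s i) (t i))"
    using tensor_decomp_sum[OF A A assms] by blast
  show ?thesis
    unfolding R13_R23_sum[OF st R] by (intro sum_in_carr is_vspace_tensor tens_in_tensor \<mu>_in \<alpha>_in st)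
qed

lemma R13_R12_in:
  assumes "R \<in> carr (tensor A A)"
  shows "R13_R12 A \<mu> \<alpha> R \<in> carr (tensor A (tensor A A))"
proof -
  obtain n s t where st: "\<And>i. s i \<in> carr A" "\<And>i. t i \<in> carr A"
    and R: "R = (\<Sum>i<(n::nat). tens A A (s i) (t i))"
    using tensor_decomp_sum[OF A A assms] by blast
  show ?thesis
    unfolding R13_R12_sum[OF st R] by (intro sum_in_carr is_vspace_tensor tens_in_tensor \<mu>_in \<alpha>_in st)
qed

text \<open>With \<open>R = \<Sum> s\<^sub>i \<otimes> t\<^sub>i\<close>, the left side is
\<open>\<Sum> \<phi>(\<alpha> s\<^sub>i) \<psi>(\<alpha> s\<^sub>j) \<chi>\<^sub>1(t\<^sub>i) \<chi>\<^sub>2(t\<^sub>j)\<close>, and the two components of \<open>\<mu>\<^sup>*(\<chi>)\<close>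
contract to \<open>\<chi>(t\<^sub>i t\<^sub>j)\<close>.\<close>

lemma cobraid_mul_left:
  assumes R: "R \<in> carr (tensor A A)" and \<phi>: "\<phi> \<in> carr D" and \<psi>: "\<psi> \<in> carr D" and \<chi>: "\<chi> \<in> carr D"
  shows "tensor_lift D D (\<lambda>\<chi>1 \<chi>2. form_of A R (tens D D (twist \<phi>) \<chi>1) * form_of A R (tens D D (twist \<psi>) \<chi>2))
      (comul \<chi>)
    = tensor_form (tensor A A) A (tensor_form A A \<phi> \<psi>) \<chi> (R13_R23 A \<mu> \<alpha> R)"
proof -
  obtain n s t where st: "\<And>i. s i \<in> carr A" "\<And>i. t i \<in> carr A"
    and n: "R = (\<Sum>i<(n::nat). tens A A (s i) (t i))"
    using tensor_decomp_sum[OF A A R] by blast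
  obtain m p q where pq: "\<And>i. p i \<in> carr D" "\<And>i. q i \<in> carr D"
    and m: "comul \<chi> = (\<Sum>i<(m::nat). tens D D (p i) (q i))"
      "\<And>x y. x \<in> carr A \<Longrightarrow> y \<in> carr A \<Longrightarrow> (\<Sum>i<m. p i x * q i y) = \<chi> (\<mu> x y)"
    using dual_comult_decomp[OF A fin \<mu> \<chi>] by blast
  have r: "form_of A R (tens D D (twist \<phi>) \<xi>) = (\<Sum>i<n. \<phi> (\<alpha> (s i)) * \<xi> (t i))"
    if "\<phi> \<in> carr D" "\<xi> \<in> carr D" for \<phi> \<xi>
    by (simp add: form_of_tens R that twist_in)
      (simp add: n tensor_form_tens_sum A dual_linear that twist_in st twist_apply)
  have "tensor_lift D D (\<lambda>\<chi>1 \<chi>2. form_of A R (tens D D (twist \<phi>) \<chi>1) * form_of A R (tens D D (twist \<psi>) \<chi>2))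
      (comul \<chi>)
    = (\<Sum>k<m. form_of A R (tens D D (twist \<phi>) (p k)) * form_of A R (tens D D (twist \<psi>) (q k)))"
    unfolding m(1) tensor_form_def[symmetric]
    by (intro tensor_form_tens_sum[OF D D _ _ pq] linear_form_of_tens(1) R twist_in \<phi> \<psi>)
  also have "\<dots> = (\<Sum>i<n. \<Sum>j<n. \<phi> (\<alpha> (s i)) * \<psi> (\<alpha> (s j)) * \<chi> (\<mu> (t i) (t j)))"
    by (simp add: r \<phi> \<psi> pq sum_mult_contract m(2) st)
  also have "\<dots> = tensor_form (tensor A A) A (tensor_form A A \<phi> \<psi>) \<chi> (R13_R23 A \<mu> \<alpha> R)"
  proof -
    have "linear_map (tensor (tensor A A) A) base_field
        (tensor_form (tensor A A) A (tensor_form A A \<phi> \<psi>) \<chi>)"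
      by (intro linear_tensor_form A AA dual_linear \<phi> \<psi> \<chi>)
    then have "tensor_form (tensor A A) A (tensor_form A A \<phi> \<psi>) \<chi> (R13_R23 A \<mu> \<alpha> R)
      = (\<Sum>i<n. \<Sum>j<n. tensor_form (tensor A A) A (tensor_form A A \<phi> \<psi>) \<chi>
          (tens (tensor A A) A (tens A A (\<alpha> (s i)) (\<alpha> (s j))) (\<mu> (t i) (t j))))"
      unfolding R13_R23_sum[OF st n]
      by (rule linear_map_double_sum_arg[OF is_vspace_tensor]) (intro tens_in_tensor \<mu>_in \<alpha>_in st)
    then show ?thesis
      by (simp add: tensor_form_tens tens_in_tensor linear_tensor_form A AA
          dual_linear \<phi> \<psi> \<chi> \<mu>_in \<alpha>_in st)
  qed
  finally show ?thesis .
qed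

text \<open>Here \<open>\<phi>\<^sub>1(s\<^sub>i) \<phi>\<^sub>2(s\<^sub>j)\<close> contracts to \<open>\<phi>(s\<^sub>i s\<^sub>j)\<close>. The functional \<open>\<chi>\<close> goes with \<open>\<phi>\<^sub>1\<close>,
hence with \<open>t\<^sub>i\<close>, although it is the last one: this is why the factors in the definition of
\<open>R\<^sub>1\<^sub>3R\<^sub>1\<^sub>2\<close> appear in the order \<open>\<alpha>(t\<^sub>j) \<otimes> \<alpha>(t\<^sub>i)\<close>.\<close>

lemma cobraid_mul_right:
  assumes R: "R \<in> carr (tensor A A)" and \<phi>: "\<phi> \<in> carr D" and \<psi>: "\<psi> \<in> carr D" and \<chi>: "\<chi> \<in> carr D"
  shows "tensor_lift D D (\<lambda>\<phi>1 \<phi>2. form_of A R (tens D D \<phi>1 (twist \<chi>)) * form_of A R (tens D D \<phi>2 (twist \<psi>)))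
      (comul \<phi>)
    = tensor_form A (tensor A A) \<phi> (tensor_form A A \<psi> \<chi>) (R13_R12 A \<mu> \<alpha> R)"
proof -
  obtain n s t where st: "\<And>i. s i \<in> carr A" "\<And>i. t i \<in> carr A"
    and n: "R = (\<Sum>i<(n::nat). tens A A (s i) (t i))"
    using tensor_decomp_sum[OF A A R] by blast
  obtain m p q where pq: "\<And>i. p i \<in> carr D" "\<And>i. q i \<in> carr D"
    and m: "comul \<phi> = (\<Sum>i<(m::nat). tens D D (p i) (q i))"
      "\<And>x y. x \<in> carr A \<Longrightarrow> y \<in> carr A \<Longrightarrow> (\<Sum>i<m. p i x * q i y) = \<phi> (\<mu> x y)"
    using dual_comult_decomp[OF A fin \<mu> \<phi>] by blast
  have r: "form_of A R (tens D D \<xi> (twist \<psi>)) = (\<Sum>i<n. \<psi> (\<alpha> (t i)) * \<xi> (s i))"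
    if "\<psi> \<in> carr D" "\<xi> \<in> carr D" for \<psi> \<xi>
    by (simp add: form_of_tens R that twist_in)
      (simp add: n tensor_form_tens_sum A dual_linear that twist_in st twist_apply mult.commute)
  have "tensor_lift D D (\<lambda>\<phi>1 \<phi>2. form_of A R (tens D D \<phi>1 (twist \<chi>)) * form_of A R (tens D D \<phi>2 (twist \<psi>)))
      (comul \<phi>)
    = (\<Sum>k<m. form_of A R (tens D D (p k) (twist \<chi>)) * form_of A R (tens D D (q k) (twist \<psi>)))"
    unfolding m(1) tensor_form_def[symmetric]
    by (intro tensor_form_tens_sum[OF D D _ _ pq] linear_form_of_tens(2) R twist_in \<chi> \<psi>)
  also have "\<dots> = (\<Sum>i<n. \<Sum>j<n. \<phi> (\<mu> (s i) (s j)) * (\<psi> (\<alpha> (t j)) * \<chi> (\<alpha> (t i))))"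
    by (simp add: r \<chi> \<psi> pq sum_mult_contract m(2) st mult_ac)
  also have "\<dots> = tensor_form A (tensor A A) \<phi> (tensor_form A A \<psi> \<chi>) (R13_R12 A \<mu> \<alpha> R)"
  proof -
    have "linear_map (tensor A (tensor A A)) base_field
        (tensor_form A (tensor A A) \<phi> (tensor_form A A \<psi> \<chi>))"
      by (intro linear_tensor_form A AA dual_linear \<phi> \<psi> \<chi>)
    then have "tensor_form A (tensor A A) \<phi> (tensor_form A A \<psi> \<chi>) (R13_R12 A \<mu> \<alpha> R)
      = (\<Sum>i<n. \<Sum>j<n. tensor_form A (tensor A A) \<phi> (tensor_form A A \<psi> \<chi>)
          (tens A (tensor A A) (\<mu> (s i) (s j)) (tens A A (\<alpha> (t j)) (\<alpha> (t i)))))"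
      unfolding R13_R12_sum[OF st n]
      by (rule linear_map_double_sum_arg[OF is_vspace_tensor]) (intro tens_in_tensor \<mu>_in \<alpha>_in st)
    then show ?thesis
      by (simp add: tensor_form_tens tens_in_tensor linear_tensor_form A AA
          dual_linear \<phi> \<psi> \<chi> \<mu>_in \<alpha>_in st)
  qed
  finally show ?thesis .
qed

text \<open>At \<open>z\<close> the left side of the commutation axiom is
\<open>\<Sum> \<psi>\<^sub>1(z\<^sub>1) \<phi>\<^sub>1(z\<^sub>2) \<phi>\<^sub>2(s\<^sub>h) \<psi>\<^sub>2(t\<^sub>h) = \<Sum> \<phi>(z\<^sub>2 s\<^sub>h) \<psi>(z\<^sub>1 t\<^sub>h)\<close>, in which the order of
\<open>z\<^sub>1\<close> and \<open>z\<^sub>2\<close> has become the flip; the right side is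
\<open>\<Sum> \<phi>\<^sub>1(s\<^sub>g) \<psi>\<^sub>1(t\<^sub>g) \<phi>\<^sub>2(z\<^sub>1) \<psi>\<^sub>2(z\<^sub>2) = \<Sum> \<phi>(s\<^sub>g z\<^sub>1) \<psi>(t\<^sub>g z\<^sub>2)\<close>.\<close>

lemma cobraid_commute:
  assumes R: "R \<in> carr (tensor A A)" and \<phi>: "\<phi> \<in> carr D" and \<psi>: "\<psi> \<in> carr D"
  defines "L \<equiv> tensor_lift D D (\<lambda>\<phi>1 \<phi>2. tensor_lift D D (\<lambda>\<psi>1 \<psi>2.
      smul D (form_of A R (tens D D \<phi>2 \<psi>2)) (mul \<psi>1 \<phi>1)) (comul \<psi>)) (comul \<phi>)"
    and "N \<equiv> tensor_lift D D (\<lambda>\<phi>1 \<phi>2. tensor_lift D D (\<lambda>\<psi>1 \<psi>2.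
      smul D (form_of A R (tens D D \<phi>1 \<psi>1)) (mul \<phi>2 \<psi>2)) (comul \<psi>)) (comul \<phi>)"
  shows "L \<in> carr D"
    and "N \<in> carr D"
    and "z \<in> carr A \<Longrightarrow> L z = tensor_form A A \<phi> \<psi> (tensor_mult A \<mu> (tensor_flip A (\<Delta> z)) R)"
    and "z \<in> carr A \<Longrightarrow> N z = tensor_form A A \<phi> \<psi> (tensor_mult A \<mu> R (\<Delta> z))"
proof -
  obtain n s t where st: "\<And>i. s i \<in> carr A" "\<And>i. t i \<in> carr A"
    and n: "R = (\<Sum>i<(n::nat). tens A A (s i) (t i))"
    using tensor_decomp_sum[OF A A R] by blast
  obtain m p q where pq: "\<And>i. p i \<in> carr D" "\<And>i. q i \<in> carr D"
    and m: "comul \<phi> = (\<Sum>i<(m::nat). tens D D (p i) (q i))"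
      "\<And>x y. x \<in> carr A \<Longrightarrow> y \<in> carr A \<Longrightarrow> (\<Sum>i<m. p i x * q i y) = \<phi> (\<mu> x y)"
    using dual_comult_decomp[OF A fin \<mu> \<phi>] by blast
  obtain l u v where uv: "\<And>i. u i \<in> carr D" "\<And>i. v i \<in> carr D"
    and l: "comul \<psi> = (\<Sum>i<(l::nat). tens D D (u i) (v i))"
      "\<And>x y. x \<in> carr A \<Longrightarrow> y \<in> carr A \<Longrightarrow> (\<Sum>i<l. u i x * v i y) = \<psi> (\<mu> x y)"
    using dual_comult_decomp[OF A fin \<mu> \<psi>] by blast
  have r: "form_of A R (tens D D \<xi> \<eta>) = (\<Sum>i<n. \<xi> (s i) * \<eta> (t i))"
    if "\<xi> \<in> carr D" "\<eta> \<in> carr D" for \<xi> \<eta>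
    by (simp add: form_of_tens R that)
      (simp add: n tensor_form_tens_sum A dual_linear that st)
  have L: "L = (\<Sum>i<m. \<Sum>j<l. smul D (form_of A R (tens D D (q i) (v j))) (mul (u j) (p i)))"
    unfolding L_def m(1) l(1)
    by (rule tensor_lift_lift_tens_sum[OF D D D D D _ _ _ _ pq uv])
      (intro linear_smul_vector linear_smul_scalar linear_form_of_tens D R bilinear_mapD[OF bilinear_mul]; assumption)+
  have N: "N = (\<Sum>i<m. \<Sum>j<l. smul D (form_of A R (tens D D (p i) (u j))) (mul (q i) (v j)))"
    unfolding N_def m(1) l(1)
    by (rule tensor_lift_lift_tens_sum[OF D D D D D _ _ _ _ pq uv])
      (intro linear_smul_vector linear_smul_scalar linear_form_of_tens D R bilinear_mapD[OF bilinear_mul]; assumption)+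
  show "L \<in> carr D" unfolding L by (intro sum_in_carr D is_vspaceD(3)[OF D] mul_in pq uv)
  show "N \<in> carr D" unfolding N by (intro sum_in_carr D is_vspaceD(3)[OF D] mul_in pq uv)
  assume z: "z \<in> carr A"
  obtain k a b where ab: "\<And>i. a i \<in> carr A" "\<And>i. b i \<in> carr A"
    and k: "\<Delta> z = (\<Sum>i<(k::nat). tens A A (a i) (b i))"
    using tensor_decomp_sum[OF A A \<Delta>_in[OF z]] by blast
  have mul_z: "mul \<xi> \<eta> z = (\<Sum>g<k. \<xi> (a g) * \<eta> (b g))" if "\<xi> \<in> carr D" "\<eta> \<in> carr D" for \<xi> \<eta>
    by (simp add: mul_apply z k tensor_form_tens_sum A dual_linear that ab)
  have "L z = (\<Sum>i<m. \<Sum>j<l. (\<Sum>g<k. p i (b g) * u j (a g)) * (\<Sum>h<n. q i (s h) * v j (t h)))"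
    unfolding L by (simp add: sum_fun_apply mul_z r pq uv mult.commute)
  also have "\<dots> = (\<Sum>g<k. \<Sum>h<n. (\<Sum>i<m. p i (b g) * q i (s h)) * (\<Sum>j<l. u j (a g) * v j (t h)))"
    by (rule sum_swap_middle[symmetric])
  also have "\<dots> = (\<Sum>g<k. \<Sum>h<n. \<phi> (\<mu> (b g) (s h)) * \<psi> (\<mu> (a g) (t h)))"
    by (simp add: m(2) l(2) ab st)
  also have "\<dots> = tensor_form A A \<phi> \<psi> (tensor_mult A \<mu> (tensor_flip A (\<Delta> z)) R)"
    unfolding k n tensor_flip_tens_sum[OF A ab]
    by (rule tensor_form_tensor_mult[OF A \<mu> ab(2,1) st dual_linear[OF \<phi>] dual_linear[OF \<psi>], symmetric])
  finally show "L z = tensor_form A A \<phi> \<psi> (tensor_mult A \<mu> (tensor_flip A (\<Delta> z)) R)" .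
  have "N z = (\<Sum>i<m. \<Sum>j<l. (\<Sum>g<n. p i (s g) * u j (t g)) * (\<Sum>h<k. q i (a h) * v j (b h)))"
    unfolding N by (simp add: sum_fun_apply mul_z r pq uv)
  also have "\<dots> = (\<Sum>g<n. \<Sum>h<k. (\<Sum>i<m. p i (s g) * q i (a h)) * (\<Sum>j<l. u j (t g) * v j (b h)))"
    by (rule sum_swap_middle[symmetric])
  also have "\<dots> = (\<Sum>g<n. \<Sum>h<k. \<phi> (\<mu> (s g) (a h)) * \<psi> (\<mu> (t g) (b h)))"
    by (simp add: m(2) l(2) ab st)
  also have "\<dots> = tensor_form A A \<phi> \<psi> (tensor_mult A \<mu> R (\<Delta> z))"
    unfolding k n
    by (rule tensor_form_tensor_mult[OF A \<mu> st ab dual_linear[OF \<phi>] dual_linear[OF \<psi>], symmetric])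
  finally show "N z = tensor_form A A \<phi> \<psi> (tensor_mult A \<mu> R (\<Delta> z))" .
qed

lemma braid_comult_left_iff:
  assumes R: "R \<in> carr (tensor A A)"
  shows "\<Delta>\<alpha> R = R13_R23 A \<mu> \<alpha> R \<longleftrightarrow>
    (\<forall>\<phi>\<in>carr D. \<forall>\<psi>\<in>carr D. \<forall>\<chi>\<in>carr D.
      form_of A R (tens D D (mul \<phi> \<psi>) (twist \<chi>)) = tensor_lift D D (\<lambda>\<chi>1 \<chi>2.
        form_of A R (tens D D (twist \<phi>) \<chi>1) * form_of A R (tens D D (twist \<psi>) \<chi>2)) (comul \<chi>))"
    (is "_ \<longleftrightarrow> ?rhs")
proof -
  have "?rhs \<longleftrightarrow> (\<forall>\<phi>\<in>carr D. \<forall>\<psi>\<in>carr D. \<forall>\<chi>\<in>carr D.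
      tensor_form (tensor A A) A (tensor_form A A \<phi> \<psi>) \<chi> (\<Delta>\<alpha> R)
      = tensor_form (tensor A A) A (tensor_form A A \<phi> \<psi>) \<chi> (R13_R23 A \<mu> \<alpha> R))"
    by (simp add: form_of_tens R mul_in twist_in form_\<Delta>\<alpha> cobraid_mul_left)
  also have "\<dots> \<longleftrightarrow> \<Delta>\<alpha> R = R13_R23 A \<mu> \<alpha> R"
    using tensor_left_eqI[OF A fin \<Delta>\<alpha>_in[OF R] R13_R23_in[OF R]] by auto
  finally show ?thesis by blast
qed

lemma braid_comult_right_iff:
  assumes R: "R \<in> carr (tensor A A)"
  shows "\<alpha>\<Delta> R = R13_R12 A \<mu> \<alpha> R \<longleftrightarrow>
    (\<forall>\<phi>\<in>carr D. \<forall>\<psi>\<in>carr D. \<forall>\<chi>\<in>carr D.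
      form_of A R (tens D D (twist \<phi>) (mul \<psi> \<chi>)) = tensor_lift D D (\<lambda>\<phi>1 \<phi>2.
        form_of A R (tens D D \<phi>1 (twist \<chi>)) * form_of A R (tens D D \<phi>2 (twist \<psi>))) (comul \<phi>))"
    (is "_ \<longleftrightarrow> ?rhs")
proof -
  have "?rhs \<longleftrightarrow> (\<forall>\<phi>\<in>carr D. \<forall>\<psi>\<in>carr D. \<forall>\<chi>\<in>carr D.
      tensor_form A (tensor A A) \<phi> (tensor_form A A \<psi> \<chi>) (\<alpha>\<Delta> R)
      = tensor_form A (tensor A A) \<phi> (tensor_form A A \<psi> \<chi>) (R13_R12 A \<mu> \<alpha> R))"
    by (simp add: form_of_tens R mul_in twist_in form_\<alpha>\<Delta> cobraid_mul_right)
  also have "\<dots> \<longleftrightarrow> \<alpha>\<Delta> R = R13_R12 A \<mu> \<alpha> R"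
    using tensor_right_eqI[OF A fin \<alpha>\<Delta>_in[OF R] R13_R12_in[OF R]] by auto
  finally show ?thesis by blast
qed

text \<open>Two families of functionals on \<open>A\<close>, indexed by \<open>\<phi>\<close> and \<open>\<psi>\<close>, are compared on one side and two
families of tensors, indexed by \<open>z\<close>, on the other. Both comparisons amount to equality of the
scalars in \<open>cobraid_commute\<close> for all \<open>\<phi>, \<psi>, z\<close>.\<close>

lemma braid_commute_iff:
  assumes R: "R \<in> carr (tensor A A)"
  shows "(\<forall>z\<in>carr A. tensor_mult A \<mu> (tensor_flip A (\<Delta> z)) R = tensor_mult A \<mu> R (\<Delta> z)) \<longleftrightarrow>
    (\<forall>\<phi>\<in>carr D. \<forall>\<psi>\<in>carr D.
      tensor_lift D D (\<lambda>\<phi>1 \<phi>2. tensor_lift D D (\<lambda>\<psi>1 \<psi>2.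
        smul D (form_of A R (tens D D \<phi>2 \<psi>2)) (mul \<psi>1 \<phi>1)) (comul \<psi>)) (comul \<phi>) =
      tensor_lift D D (\<lambda>\<phi>1 \<phi>2. tensor_lift D D (\<lambda>\<psi>1 \<psi>2.
        smul D (form_of A R (tens D D \<phi>1 \<psi>1)) (mul \<phi>2 \<psi>2)) (comul \<psi>)) (comul \<phi>))"
    (is "_ \<longleftrightarrow> (\<forall>\<phi>\<in>carr D. \<forall>\<psi>\<in>carr D. ?L \<phi> \<psi> = ?N \<phi> \<psi>)")
proof -
  let ?S = "\<lambda>z. tensor_mult A \<mu> (tensor_flip A (\<Delta> z)) R" and ?T = "\<lambda>z. tensor_mult A \<mu> R (\<Delta> z)"
  have S: "?S z \<in> carr (tensor A A)" and T: "?T z \<in> carr (tensor A A)" if "z \<in> carr A" for z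
    by (intro tensor_mult_in_carr tensor_flip_in A \<mu> R \<Delta>_in that)+
  have "?L \<phi> \<psi> = ?N \<phi> \<psi> \<longleftrightarrow>
      (\<forall>z\<in>carr A. tensor_form A A \<phi> \<psi> (?S z) = tensor_form A A \<phi> \<psi> (?T z))"
    if \<phi>: "\<phi> \<in> carr D" and \<psi>: "\<psi> \<in> carr D" for \<phi> \<psi>
  proof -
    note c = cobraid_commute[OF R \<phi> \<psi>]
    have "?L \<phi> \<psi> = ?N \<phi> \<psi> \<longleftrightarrow> (\<forall>z\<in>carr A. ?L \<phi> \<psi> z = ?N \<phi> \<psi> z)"
      using dual_eqI[OF c(1,2)] by auto
    then show ?thesis by (simp only: c(3,4) cong: ball_cong)
  qed
  then have "(\<forall>\<phi>\<in>carr D. \<forall>\<psi>\<in>carr D. ?L \<phi> \<psi> = ?N \<phi> \<psi>) \<longleftrightarrow>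
      (\<forall>z\<in>carr A. \<forall>\<phi>\<in>carr D. \<forall>\<psi>\<in>carr D. tensor_form A A \<phi> \<psi> (?S z) = tensor_form A A \<phi> \<psi> (?T z))"
    by blast
  also have "\<dots> \<longleftrightarrow> (\<forall>z\<in>carr A. ?S z = ?T z)"
    using tensor_eqI[OF A fin S T] by auto
  finally show ?thesis by blast
qed

text \<open>Composing the form of \<open>R\<close> with \<open>\<alpha>\<^sup>* \<otimes> \<alpha>\<^sup>*\<close> gives the form of \<open>(\<alpha> \<otimes> \<alpha>)(R)\<close>, and a tensor is
determined by its form.\<close>

lemma twist_invariant_iff:
  assumes R: "R \<in> carr (tensor A A)"
  shows "R = tensor_map A A A A \<alpha> \<alpha> R \<longleftrightarrow>
    (\<forall>T\<in>carr (tensor D D). form_of A R T = form_of A R (tensor_map D D D D twist twist T))"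
proof -
  let ?S = "tensor_map A A A A \<alpha> \<alpha> R"
  have S: "?S \<in> carr (tensor A A)" by (rule \<alpha>\<alpha>_in[OF R])
  have pull: "form_of A R (tensor_map D D D D twist twist T) = form_of A ?S T"
    if T: "T \<in> carr (tensor D D)" for T
  proof (rule linear_ext_tens[OF D D is_vspace_base_field _ linear_form_of[OF S] _ T])
    show "linear_map (tensor D D) base_field (\<lambda>T. form_of A R (tensor_map D D D D twist twist T))"
      by (rule linear_map_compose[OF linear_tensor_map[OF D D D D linear_twist linear_twist] linear_form_of[OF R]])
    have b: "bilinear_map D D (tensor D D) (\<lambda>x y. tens D D (twist x) (twist y))"
      by (rule bilinear_tens_map[OF D D linear_twist linear_twist])
    show "form_of A R (tensor_map D D D D twist twist (tens D D \<phi> \<psi>)) = form_of A ?S (tens D D \<phi> \<psi>)"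
      if "\<phi> \<in> carr D" "\<psi> \<in> carr D" for \<phi> \<psi>
      by (simp add: tensor_map_def tensor_universal(2)[OF D D is_vspace_tensor b that])
        (simp add: form_of_tens R S that twist_in form_\<alpha>\<alpha> tensor_map_def[symmetric])
  qed
  have "R = ?S" if eq: "\<forall>T\<in>carr (tensor D D). form_of A R T = form_of A ?S T"
  proof (rule tensor_eqI[OF A fin R S])
    show "tensor_form A A \<phi> \<psi> R = tensor_form A A \<phi> \<psi> ?S" if "\<phi> \<in> carr D" "\<psi> \<in> carr D" for \<phi> \<psi>
      using eq[rule_format, OF tens_in_tensor[OF that]] by (simp add: form_of_tens R S that)
  qed
  then have "R = ?S \<longleftrightarrow> (\<forall>T\<in>carr (tensor D D). form_of A R T = form_of A ?S T)" by auto
  also have "\<dots> \<longleftrightarrow> (\<forall>T\<in>carr (tensor D D). form_of A R T = form_of A R (tensor_map D D D D twist twist T))"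
    by (simp add: pull)
  finally show ?thesis .
qed

theorem braided_iff_cobraided_dual:
  assumes R: "R \<in> carr (tensor A A)"
  shows "braided_hom_bialgebra A \<mu> \<Delta> \<alpha> R \<longleftrightarrow> cobraided_hom_bialgebra D mul comul twist (form_of A R)"
  unfolding braided_hom_bialgebra_def cobraided_hom_bialgebra_def
    braid_comult_left_iff[OF R] braid_comult_right_iff[OF R] braid_commute_iff[OF R]
  using bialg R hom_bialgebra_dual linear_form_of[OF R] by blast

end


section \<open>Braided and cobraided Hom-bialgebras under duality\<close>

theorem theorem6p3:
  fixes A :: "('k::field_char_0, 'v::ab_group_add) vspace"
    and \<mu> :: "'v \<Rightarrow> 'v \<Rightarrow> 'v"
    and \<Delta> :: "'v \<Rightarrow> ('v \<Rightarrow> 'v \<Rightarrow> 'k) \<Rightarrow> 'k"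
    and \<alpha> :: "'v \<Rightarrow> 'v"
    and R :: "('v \<Rightarrow> 'v \<Rightarrow> 'k) \<Rightarrow> 'k"
  assumes "hom_bialgebra A \<mu> \<Delta> \<alpha>"
    and "finite_dim A"
    and "R \<in> carr (tensor A A)"
  shows "(braided_hom_bialgebra A \<mu> \<Delta> \<alpha> R \<longleftrightarrow>
          cobraided_hom_bialgebra (dual A) (dual_mult A \<Delta>) (dual_comult A \<mu>) (dual_map A \<alpha>)
            (form_of A R)) \<and>
         (R = tensor_map A A A A \<alpha> \<alpha> R \<longleftrightarrow>
          (\<forall>T \<in> carr (tensor (dual A) (dual A)).
             form_of A R T =
             form_of A R (tensor_map (dual A) (dual A) (dual A) (dual A)
                            (dual_map A \<alpha>) (dual_map A \<alpha>) T)))"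
proof -
  interpret finite_dim_hom_bialgebra A \<mu> \<Delta> \<alpha>
    by unfold_locales (fact assms(1), fact assms(2))
  show ?thesis
    using braided_iff_cobraided_dual[OF assms(3)] twist_invariant_iff[OF assms(3)] ..
qed

end
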